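(* Let $q>1$ be a real number, and let $G=(1+\sqrt5)/2$. (i) If $q\in(1,G]$, then $\mathcal U_q$ consists merely of the endpoints of $J_q$. (ii) If $q\in(G,q')\cup(2,q'')$, then $|\mathcal U_q|=\aleph_0$. (iii) If $q\in[q',2]\cup[q'',\infty)$, then $|\mathcal U_q|=2^{\aleph_0}$.
   Context: For a real $q>1$, let $\lceil q\rceil$ be the smallest integer $\ge q$ and let $J_q=[0,(\lceil q\rceil-1)/(q-1)]$. An expansion of a real number $x$ in base $q$ is a sequence $(c_i)_{i\ge1}$ of integers with $0\le c_i<q$ for all $i\ge1$ and $x=\sum_{i\ge1}c_iq^{-i}$. $\mathcal U_q$ is the set of real numbers $x$ having exactly one expansion in base $q$. $\mathcal U$ is the set of real numbers $q>1$ for which $1$ has exactly one expansion in base $q$. $q'\approx1.787$ denotes the smallest element of $\mathcal U$; the unique expansion of $1$ in base $q'$ is the truncated Thue--Morse sequence $(\tau_i)=11010011\ldots$, defined by $\tau_{2^N}=1$ for $N=0,1,2,\dots$ and $\tau_{2^N+i}=1-\tau_i$ for $1\le i<2^N$, $N=1,2,\dots$. $q''$ denotes the smallest element of $\mathcal U\cap(2,3)$; the unique expansion of $1$ in base $q''$ is $(\lambda_i)=21020121\ldots$ with $\lambda_i=\tau_i+\tau_{2i-1}$, $i\ge1$. *)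

theory Defs
  imports Complex_Main "HOL-Library.Equipollence"
begin

text \<open>Digit sequences are indexed from 0, so \<open>c i\<close> is the digit \<open>c\<^sub>i\<^sub>+\<^sub>1\<close> of the usual
  notation \<open>(c\<^sub>i)\<close> with \<open>i \<ge> 1\<close> and carries the weight \<open>1 / q ^ (i + 1)\<close>. The digit bound
  is strict, so for an integer base \<open>q\<close> the digit \<open>q\<close> itself is not admitted.\<close>

definition expansion :: "real \<Rightarrow> real \<Rightarrow> (nat \<Rightarrow> int) \<Rightarrow> bool" where
  "expansion q x c \<longleftrightarrow>
     (\<forall>i. 0 \<le> c i \<and> of_int (c i) < q) \<and> (\<lambda>i. of_int (c i) / q ^ Suc i) sums x"

definition univoque_numbers :: "real \<Rightarrow> real set" where
  "univoque_numbers q = {x. \<exists>!c. expansion q x c}"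

definition univoque_bases :: "real set" where
  "univoque_bases = {q. 1 < q \<and> (\<exists>!c. expansion q 1 c)}"

text \<open>On the reals \<open>LEAST\<close> is meaningful only if the minimum is attained. Both minima below
  are: \<open>q_prime\<close> (about 1.787) is the base in which 1 has the truncated Thue--Morse sequence
  as its unique expansion, and \<open>q_double_prime\<close> the base in which the unique expansion of 1
  is \<open>21020121\<dots>\<close>; neither fact is built into the definitions.\<close>

definition q_prime :: real where
  "q_prime = (LEAST q. q \<in> univoque_bases)"

definition q_double_prime :: real where
  "q_double_prime = (LEAST q. q \<in> univoque_bases \<inter> {2<..<3})"

definition golden_ratio :: real where
  "golden_ratio = (1 + sqrt 5) / 2"

definition J :: "real \<Rightarrow> real set" where
  "J q = {0 .. (of_int \<lceil>q\<rceil> - 1) / (q - 1)}"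

end

theory Submission
  imports Defs "HOL-Library.Countable_Set"
begin

text \<open>Let \<open>M\<close> be the largest admissible digit, so that \<open>M < q \<le> M + 1\<close>. An expansion in base
  \<open>q\<close> is unique iff no digit can be raised or lowered, that is, iff the tail behind every digit
  less than \<open>M\<close>, and the reflected tail behind every positive digit, has value less than 1
  (\<open>univoque_numbers_eq\<close>). Since values decrease in \<open>q\<close>, the set of these sequences increases
  with \<open>q\<close> as long as \<open>M\<close> is fixed.

  For \<open>M \<ge> 3\<close> all sequences over \<open>{1, 2}\<close> are univoque. For \<open>M = 1\<close>, a non-constant univoque
  sequence forces \<open>q\<^sup>2 > q + 1\<close>, which gives the first claim; for \<open>q\<close> above the golden ratio the
  sequences 0\<open>\<dots>\<close>0101010\<open>\<dots>\<close> are univoque, and so are the sequences 0\<open>\<dots>\<close>0111\<open>\<dots>\<close> for \<open>M = 2\<close>,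
  so there are infinitely many.

  The remaining claims concern \<open>M = 1\<close> and \<open>M = 2\<close> and are proved together. Let \<open>\<beta>\<close> be the
  truncated Thue--Morse sequence 1101\<open>\<dots>\<close> or the sequence 2102\<open>\<dots>\<close>, and let \<open>p\<close> be the base in
  which \<open>\<beta>\<close> has value 1. The statement \<open>value < 1\<close> is translated into lexicographic order with
  respect to \<open>\<beta>\<close>: sequences all of whose tails are below \<open>\<beta>\<close> have small values in base \<open>p\<close>
  (\<open>val_lt_1_if_lexle\<close>), and small values imply lexicographic order (\<open>lexle_if_val_less\<close>).

  From \<open>p\<close> on there are continuum many univoque numbers. With \<open>\<phi>\<close> the Thue--Morse
  substitution 0 to 01, 1 to 10, the truncated Thue--Morse sequence satisfies \<open>\<tau> = 1 \<phi>(\<tau>)\<close>.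
  Replacing the letter 1 by an arbitrary bit at each stage of this self-similarity gives a sequence
  for every set of natural numbers, and all tails of these sequences are at most \<open>\<tau>\<close>
  (\<open>shift_thue_morse_seq_le\<close>). The case \<open>M = 2\<close> follows by passing to differences of
  consecutive digits.

  Below \<open>p\<close> some finite prefix of \<open>\<beta>\<close> already has value greater than 1, so for some \<open>n\<close> and
  far enough out, no tail of a non-constant univoque sequence starts with the prefix of \<open>\<beta>\<close> of
  length \<open>2\<^sup>n\<close>. By the doubling structure of \<open>\<beta>\<close>, such a sequence must be eventually periodic
  if it contains the prefix of length \<open>2\<^sup>n\<^sup>-\<^sup>1\<close> or its reflection far enough out
  (\<open>block_forces_periodic\<close>), and induction on \<open>n\<close> leaves countably many
  sequences. The same lemma shows that 1 has no unique
  expansion in a base strictly between \<open>M\<close> and \<open>p\<close>, since such an expansion would be periodic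
  while all its proper tails have value less than 1. Hence \<open>p\<close> is the least univoque base greater
  than \<open>M\<close>.\<close>

section \<open>Values of digit sequences\<close>

text \<open>The digit sequences over the alphabet \<open>{0, \<dots>, M}\<close>. For a base \<open>q\<close> with
  \<open>M < q \<le> M + 1\<close> these are the sequences admitted in expansions.\<close>
definition digits :: "int \<Rightarrow> (nat \<Rightarrow> int) set" where
  "digits M = {c. \<forall>i. 0 \<le> c i \<and> c i \<le> M}"

text \<open>The number represented by \<open>c\<close> in base \<open>q\<close>. The base is not tied to the alphabet, so that
  the same sequence can be evaluated in different bases.\<close>
definition val :: "real \<Rightarrow> (nat \<Rightarrow> int) \<Rightarrow> real" where
  "val q c = (\<Sum>i. of_int (c i) / q ^ Suc i)"

text \<open>The tail of a sequence after its first \<open>k\<close> digits.\<close>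
definition shift :: "nat \<Rightarrow> (nat \<Rightarrow> int) \<Rightarrow> nat \<Rightarrow> int" where
  "shift k c = (\<lambda>i. c (k + i))"

text \<open>The digitwise reflection \<open>c \<mapsto> M - c\<close>, which on values acts as
  \<open>x \<mapsto> M / (q - 1) - x\<close>.\<close>
definition reflect :: "int \<Rightarrow> (nat \<Rightarrow> int) \<Rightarrow> nat \<Rightarrow> int" where
  "reflect M c = (\<lambda>i. M - c i)"

lemma shift_apply [simp]: "shift k c i = c (k + i)"
  by (simp add: shift_def)

lemma reflect_apply [simp]: "reflect M c i = M - c i"
  by (simp add: reflect_def)

lemma shift_shift [simp]: "shift j (shift k c) = shift (k + j) c"
  by (simp add: fun_eq_iff add.assoc)

lemma shift_0 [simp]: "shift 0 c = c"
  by (simp add: fun_eq_iff)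

lemma reflect_reflect [simp]: "reflect M (reflect M c) = c"
  by (simp add: fun_eq_iff)

lemma shift_reflect: "shift k (reflect M c) = reflect M (shift k c)"
  by (simp add: fun_eq_iff)

lemma reflect_eq_iff: "reflect M c = d \<longleftrightarrow> c = reflect M d"
  by auto

lemma digits_shift [intro]: "c \<in> digits M \<Longrightarrow> shift k c \<in> digits M"
  by (simp add: digits_def)

lemma digits_reflect [intro]: "c \<in> digits M \<Longrightarrow> reflect M c \<in> digits M"
  by (simp add: digits_def)

lemma digitsD: "c \<in> digits M \<Longrightarrow> 0 \<le> c i" "c \<in> digits M \<Longrightarrow> c i \<le> M"
  by (simp_all add: digits_def)

lemma sums_const_val:
  fixes q :: real
  assumes "1 < q"
  shows "(\<lambda>i. m / q ^ Suc i) sums (m / (q - 1))"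
proof -
  have "(\<lambda>i. (m / q) * (1 / q) ^ i) sums ((m / q) * (1 / (1 - 1 / q)))"
    using assms by (intro sums_mult geometric_sums) simp
  moreover have "(m / q) * (1 / (1 - 1 / q)) = m / (q - 1)"
    using assms by (simp add: field_simps)
  moreover have "(m / q) * (1 / q) ^ i = m / q ^ Suc i" for i
    by (simp add: power_divide)
  ultimately show ?thesis
    by (simp only:)
qed

lemma summable_val:
  fixes q :: real
  assumes "1 < q" "c \<in> digits M"
  shows "summable (\<lambda>i. of_int (c i) / q ^ Suc i)"
proof (rule summable_comparison_test)
  show "summable (\<lambda>i. of_int M / q ^ Suc i)"
    using sums_const_val[OF assms(1)] by (rule sums_summable)
  show "\<exists>N. \<forall>n\<ge>N. norm (of_int (c n) / q ^ Suc n :: real) \<le> of_int M / q ^ Suc n"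
    using assms digitsD[OF assms(2)] by (auto intro!: divide_right_mono)
qed

lemma val_nonneg:
  assumes "1 < q" "c \<in> digits M"
  shows "0 \<le> val q c"
  unfolding val_def
  by (rule suminf_nonneg[OF summable_val[OF assms]])
    (use assms digitsD[OF assms(2)] in simp)

lemma val_pos:
  assumes "1 < q" "c \<in> digits M" "c i \<noteq> 0"
  shows "0 < val q c"
  unfolding val_def
proof (rule suminf_pos2[OF summable_val[OF assms(1,2)]])
  show "0 \<le> real_of_int (c n) / q ^ Suc n" for n
    using assms digitsD[OF assms(2)] by simp
  have "0 < c i"
    using assms digitsD(1)[OF assms(2), of i] by simp
  then show "0 < real_of_int (c i) / q ^ Suc i"
    using assms by simp
qed

lemma val_reflect:
  assumes "1 < q" "c \<in> digits M"
  shows "val q (reflect M c) = of_int M / (q - 1) - val q c"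
proof -
  have "(\<lambda>i. of_int M / q ^ Suc i - of_int (c i) / q ^ Suc i) sums (of_int M / (q - 1) - val q c)"
    unfolding val_def
    by (intro sums_diff sums_const_val summable_sums summable_val[OF assms] assms)
  then show ?thesis
    unfolding val_def by (intro sums_unique[symmetric]) (simp add: diff_divide_distrib)
qed

lemma val_le:
  assumes "1 < q" "c \<in> digits M"
  shows "val q c \<le> of_int M / (q - 1)"
  using val_reflect[OF assms] val_nonneg[OF assms(1) digits_reflect[OF assms(2)]] by simp

lemma val_split:
  assumes "1 < q" "c \<in> digits M"
  shows "val q c = (\<Sum>i<n. of_int (c i) / q ^ Suc i) + val q (shift n c) / q ^ n"
proof -
  have "val q c = (\<Sum>i. of_int (c (i + n)) / q ^ Suc (i + n)) + (\<Sum>i<n. of_int (c i) / q ^ Suc i)"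
    unfolding val_def by (rule suminf_split_initial_segment[OF summable_val[OF assms]])
  also have "(\<Sum>i. of_int (c (i + n)) / q ^ Suc (i + n))
      = (\<Sum>i. (of_int (shift n c i) / q ^ Suc i) / q ^ n)"
    by (simp add: power_add mult_ac add.commute)
  also have "\<dots> = val q (shift n c) / q ^ n"
    unfolding val_def
    by (rule suminf_divide[OF summable_val[OF assms(1) digits_shift[OF assms(2)]]])
  finally show ?thesis
    by simp
qed

lemma val_Suc:
  assumes "1 < q" "c \<in> digits M"
  shows "val q (shift k c) = (of_int (c k) + val q (shift (Suc k) c)) / q"
  using val_split[OF assms(1) digits_shift[OF assms(2)], of k 1]
  by (simp add: add_divide_distrib)

text \<open>Two sequences that agree up to position \<open>j\<close> are compared through their digits at \<open>j\<close> and
  the values of their tails behind \<open>j\<close>. Every comparison of values below rests on this formula.\<close>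
lemma val_diff:
  assumes "1 < q" "c \<in> digits M" "d \<in> digits M" "\<And>i. i < j \<Longrightarrow> d i = c i"
  shows "val q d = val q c
    + (of_int (d j - c j) + val q (shift (Suc j) d) - val q (shift (Suc j) c)) / q ^ Suc j"
  unfolding val_split[OF assms(1,3), of "Suc j"] val_split[OF assms(1,2), of "Suc j"]
  using assms(4) by (simp add: add_divide_distrib diff_divide_distrib)

lemma val_mono_base:
  assumes "1 < q" "q \<le> r" "c \<in> digits M"
  shows "val r c \<le> val q c"
  unfolding val_def
proof (rule suminf_le)
  show "of_int (c n) / r ^ Suc n \<le> of_int (c n) / q ^ Suc n" for n
    using assms digitsD[OF assms(3)] by (intro divide_left_mono power_mono) auto
qed (rule summable_val[of _ _ M]; use assms in simp)+

lemma val_strict_mono_base: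
  assumes "1 < q" "q < r" "c \<in> digits M" "c i \<noteq> 0"
  shows "val r c < val q c"
proof -
  have le: "val r (shift (Suc i) c) / r ^ Suc i \<le> val q (shift (Suc i) c) / q ^ Suc i"
    using assms
    by (intro frac_le val_mono_base[of q r _ M] power_mono val_nonneg[of _ _ M]) auto
  have "0 < c i"
    using assms digitsD(1)[OF assms(3), of i] by simp
  have "(\<Sum>j<Suc i. of_int (c j) / r ^ Suc j) < (\<Sum>j<Suc i. of_int (c j) / q ^ Suc j)"
  proof (rule sum_strict_mono_ex1)
    show "\<forall>x\<in>{..<Suc i}. of_int (c x) / r ^ Suc x \<le> of_int (c x) / q ^ Suc x"
      using assms digitsD[OF assms(3)] by (auto intro!: divide_left_mono power_mono mult_mono)
    show "\<exists>a\<in>{..<Suc i}. of_int (c a) / r ^ Suc a < of_int (c a) / q ^ Suc a"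
      using assms \<open>0 < c i\<close>
      by (intro bexI[of _ i] divide_strict_left_mono power_strict_mono) auto
  qed simp
  then show ?thesis
    using le assms val_split[of r c M "Suc i"] val_split[of q c M "Suc i"] by simp
qed

lemma expansion_iff:
  assumes "1 < q" "of_int M < q" "q \<le> of_int M + 1"
  shows "expansion q x c \<longleftrightarrow> c \<in> digits M \<and> val q c = x"
proof -
  have lt: "real_of_int n < q \<longleftrightarrow> n \<le> M" for n
    using assms by linarith
  then have "(\<forall>i. 0 \<le> c i \<and> of_int (c i) < q) \<longleftrightarrow> c \<in> digits M"
    by (simp add: digits_def)
  then show ?thesis
    unfolding expansion_def val_def
    using summable_val[OF assms(1)] by (auto simp: sums_iff)
qed

text \<open>The greedy algorithm, capped at the digit \<open>M\<close>: the remainders stay in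
  \<open>[0, M / (q - 1)]\<close> because \<open>M \<ge> q - 1\<close>.\<close>
lemma ex_expansion:
  assumes "1 < q" "of_int M < q" "q \<le> of_int M + 1" "0 \<le> x" "x \<le> of_int M / (q - 1)"
  shows "\<exists>c\<in>digits M. val q c = x"
proof -
  define d where "d r = min M \<lfloor>q * r\<rfloor>" for r
  define r where "r = rec_nat x (\<lambda>_ r. q * r - of_int (d r))"
  have r0: "r 0 = x" and rS: "r (Suc n) = q * r n - of_int (d (r n))" for n
    by (simp_all add: r_def)
  have "0 < M"
    using assms by linarith
  have step: "0 \<le> q * y - of_int (d y)" "q * y - of_int (d y) \<le> of_int M / (q - 1)" "0 \<le> d y"
    if "0 \<le> y" "y \<le> of_int M / (q - 1)" for y
  proof -
    have 1: "1 \<le> of_int M / (q - 1)"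
      using assms by (simp add: field_simps)
    have 2: "q * y - of_int M \<le> of_int M / (q - 1)"
    proof -
      have "q * y \<le> q * (of_int M / (q - 1))"
        using that assms by (intro mult_left_mono) auto
      also have "\<dots> = of_int M + of_int M / (q - 1)"
        using assms by (simp add: field_simps)
      finally show ?thesis by simp
    qed
    show "0 \<le> q * y - of_int (d y)"
      unfolding d_def by linarith
    show "q * y - of_int (d y) \<le> of_int M / (q - 1)"
      using 1 2 unfolding d_def min_def by (auto split: if_splits) linarith
    show "0 \<le> d y"
      using that assms \<open>0 < M\<close> unfolding d_def by simp
  qed
  have r: "0 \<le> r n \<and> r n \<le> of_int M / (q - 1)" for n
    by (induction n) (use assms step in \<open>auto simp: r0 rS\<close>)
  define c where "c n = d (r n)" for n
  have c: "c \<in> digits M"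
    using step(3) r by (auto simp: digits_def c_def d_def)
  \<comment> \<open>The partial sums miss \<open>x\<close> by the current remainder.\<close>
  have part: "(\<Sum>i<n. of_int (c i) / q ^ Suc i) = x - r n / q ^ n" for n
  proof (induction n)
    case (Suc n)
    have "r (Suc n) / q ^ Suc n = r n / q ^ n - of_int (c n) / q ^ Suc n"
      using assms by (simp add: rS c_def field_simps)
    then show ?case
      using Suc by simp
  qed (simp add: r0)
  have lim: "(\<lambda>n. r n / q ^ n) \<longlonglongrightarrow> 0"
  proof (rule tendsto_sandwich[OF _ _ tendsto_const])
    show "(\<lambda>n. (of_int M / (q - 1)) * (1 / q) ^ n) \<longlonglongrightarrow> 0"
      using assms by (intro tendsto_mult_right_zero LIMSEQ_power_zero) auto
    show "\<forall>\<^sub>F n in sequentially. r n / q ^ n \<le> of_int M / (q - 1) * (1 / q) ^ n"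
      using divide_right_mono[of "r _" "of_int M / (q - 1)" "q ^ _"] r assms
      by (auto simp: power_divide intro!: always_eventually)
    show "\<forall>\<^sub>F n in sequentially. 0 \<le> r n / q ^ n"
      using r assms by (auto intro!: always_eventually)
  qed
  have "(\<lambda>i. of_int (c i) / q ^ Suc i) sums x"
    unfolding sums_def part using tendsto_diff[OF tendsto_const lim, of x] by simp
  then have "val q c = x"
    by (simp add: val_def sums_iff)
  then show ?thesis
    using c by blast
qed

section \<open>Unique expansions\<close>

text \<open>The sequences over \<open>{0, \<dots>, M}\<close> in which no digit can be raised (the following tail has
  value less than 1) and no digit can be lowered (the same for the reflected tail). For
  \<open>M < q \<le> M + 1\<close> they are exactly the unique expansions in base \<open>q\<close>. As a set of sequences
  this is increasing in \<open>q > 1\<close>.\<close>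
definition univoque_seqs :: "int \<Rightarrow> real \<Rightarrow> (nat \<Rightarrow> int) set" where
  "univoque_seqs M q = {c \<in> digits M. \<forall>n.
     (c n < M \<longrightarrow> val q (shift (Suc n) c) < 1) \<and>
     (0 < c n \<longrightarrow> val q (reflect M (shift (Suc n) c)) < 1)}"

lemma univoque_seqs_reflect:
  assumes "c \<in> univoque_seqs M q"
  shows "reflect M c \<in> univoque_seqs M q"
  using assms by (auto simp: univoque_seqs_def shift_reflect)

lemma univoque_seqs_unique:
  assumes "1 < q" "c \<in> univoque_seqs M q" "d \<in> digits M" "val q d = val q c"
  shows "d = c"
proof (rule ccontr)
  have *: False if "c \<in> univoque_seqs M q" "d \<in> digits M" "val q d = val q c"
    "\<And>i. i < j \<Longrightarrow> d i = c i" "c j < d j" for c d j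
  proof -
    have c: "c \<in> digits M" and lt: "val q (shift (Suc j) c) < 1"
      using that digitsD(2)[OF that(2), of j] by (auto simp: univoque_seqs_def)
    have "of_int (d j - c j) + val q (shift (Suc j) d) - val q (shift (Suc j) c) = 0"
      using val_diff[OF assms(1) c that(2,4)] that(3) assms(1) by simp
    moreover have "0 \<le> val q (shift (Suc j) d)" "1 \<le> real_of_int (d j - c j)"
      using that by (auto intro!: val_nonneg assms(1))
    ultimately show False
      using lt by linarith
  qed
  assume "d \<noteq> c"
  then obtain i where "d i \<noteq> c i"
    by auto
  define j where "j = (LEAST i. d i \<noteq> c i)"
  have j: "d j \<noteq> c j" "\<And>i. i < j \<Longrightarrow> d i = c i"
    unfolding j_def using LeastI[of "\<lambda>i. d i \<noteq> c i", OF \<open>d i \<noteq> c i\<close>] not_less_Least by auto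
  have c: "c \<in> digits M"
    using assms by (simp add: univoque_seqs_def)
  show False
  proof (cases "c j < d j")
    case True
    then show False
      using *[OF assms(2-4) j(2)] by blast
  next
    case False
    show False
    proof (rule *[of "reflect M c" "reflect M d" j])
      show "val q (reflect M d) = val q (reflect M c)"
        using assms c by (simp add: val_reflect)
    qed (use assms j False univoque_seqs_reflect in auto)
  qed
qed

text \<open>If the tail behind a digit less than \<open>M\<close> had value at least 1, then that digit could be
  raised and the tail replaced by an expansion of its value minus 1.\<close>
lemma val_shift_lt_1_if_unique:
  assumes q: "1 < q" "of_int M < q" "q \<le> of_int M + 1"
    and c: "c \<in> digits M" "c n < M"
    and unique: "\<And>d. d \<in> digits M \<Longrightarrow> val q d = val q c \<Longrightarrow> d = c"
  shows "val q (shift (Suc n) c) < 1"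
proof (rule ccontr)
  assume ge: "\<not> val q (shift (Suc n) c) < 1"
  have "val q (shift (Suc n) c) \<le> of_int M / (q - 1)"
    using q c by (intro val_le) auto
  with ge obtain e where e: "e \<in> digits M" "val q e = val q (shift (Suc n) c) - 1"
    using ex_expansion[OF q, of "val q (shift (Suc n) c) - 1"] by auto
  define d where "d i = (if i < n then c i else if i = n then c n + 1 else e (i - Suc n))" for i
  have d: "d \<in> digits M"
    using c e by (auto simp: d_def digits_def)
  have "shift (Suc n) d = e"
    by (auto simp: d_def fun_eq_iff)
  then have "val q d = val q c"
    using val_diff[OF q(1) c(1) d, of n] e by (simp add: d_def)
  from unique[OF d this] have "d n = c n"
    by simp
  then show False
    by (simp add: d_def)
qed

lemma univoque_numbers_eq:
  assumes q: "1 < q" "of_int M < q" "q \<le> of_int M + 1"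
  shows "univoque_numbers q = val q ` univoque_seqs M q"
proof (intro equalityI subsetI)
  fix x
  assume "x \<in> univoque_numbers q"
  then have "\<exists>!c. c \<in> digits M \<and> val q c = x"
    by (simp add: univoque_numbers_def expansion_iff[OF q])
  then obtain c where c: "c \<in> digits M" "val q c = x"
    and uniq: "\<And>d. d \<in> digits M \<Longrightarrow> val q d = x \<Longrightarrow> d = c"
    unfolding Ex1_def by metis
  have "c \<in> univoque_seqs M q"
    unfolding univoque_seqs_def
  proof (intro CollectI conjI allI impI)
    fix n
    show "val q (shift (Suc n) c) < 1" if "c n < M"
      using c(1) that
    proof (rule val_shift_lt_1_if_unique[OF q])
      show "d = c" if "d \<in> digits M" "val q d = val q c" for d
        using uniq[of d] that c(2) by simp
    qed
    have "val q (shift (Suc n) (reflect M c)) < 1" if "0 < c n"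
    proof (rule val_shift_lt_1_if_unique[OF q])
      fix d
      assume d: "d \<in> digits M" "val q d = val q (reflect M c)"
      then have "val q (reflect M d) = x"
        using c q by (simp add: val_reflect)
      then have "reflect M d = c"
        using d by (intro uniq) auto
      then show "d = reflect M c"
        by (simp add: reflect_eq_iff)
    qed (use c that in auto)
    then show "val q (reflect M (shift (Suc n) c)) < 1" if "0 < c n"
      using that by (simp add: shift_reflect)
  qed (use c in simp)
  then show "x \<in> val q ` univoque_seqs M q"
    using c by blast
next
  fix x
  assume "x \<in> val q ` univoque_seqs M q"
  then obtain c where c: "c \<in> univoque_seqs M q" "x = val q c"
    by blast
  then show "x \<in> univoque_numbers q"
    unfolding univoque_numbers_def expansion_iff[OF q]
    using univoque_seqs_unique[OF q(1) c(1)] by (auto intro!: ex1I[of _ c] simp: univoque_seqs_def)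
qed

lemma univoque_seqs_mono_base:
  assumes "1 < q" "q \<le> r"
  shows "univoque_seqs M q \<subseteq> univoque_seqs M r"
proof
  fix c
  assume c: "c \<in> univoque_seqs M q"
  then have "c \<in> digits M"
    by (simp add: univoque_seqs_def)
  then have "val r (shift (Suc n) c) \<le> val q (shift (Suc n) c)"
    "val r (reflect M (shift (Suc n) c)) \<le> val q (reflect M (shift (Suc n) c))" for n
    by (auto intro!: val_mono_base[OF assms])
  with c show "c \<in> univoque_seqs M r"
    unfolding univoque_seqs_def by (blast intro: le_less_trans)
qed

lemma constant_univoque_seqs:
  assumes "1 < q" "0 \<le> M"
  shows "(\<lambda>_. 0) \<in> univoque_seqs M q" "(\<lambda>_. M) \<in> univoque_seqs M q"
proof -
  have *: "(\<lambda>_. 0) \<in> univoque_seqs M q"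
    using assms by (auto simp: univoque_seqs_def digits_def shift_def val_def)
  have "reflect M (\<lambda>_. 0) = (\<lambda>_. M)"
    by (simp add: fun_eq_iff)
  then show "(\<lambda>_. M) \<in> univoque_seqs M q"
    using univoque_seqs_reflect[OF *] by simp
  show "(\<lambda>_. 0) \<in> univoque_seqs M q"
    by (fact *)
qed

lemma val_const: "1 < q \<Longrightarrow> val q (\<lambda>_. m) = of_int m / (q - 1)"
  unfolding val_def using sums_const_val[of q "of_int m"] by (simp add: sums_iff)

text \<open>Once a tail of a univoque sequence has value less than 1, so have all later tails: behind a
  digit \<open>M\<close> the value is \<open>q x - M\<close>, which is less than \<open>q - M \<le> 1\<close> for \<open>x < 1\<close>.\<close>
lemma val_tails_lt_1:
  assumes q: "1 < q" "q \<le> of_int M + 1" and c: "c \<in> univoque_seqs M q"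
    and "val q (shift k c) < 1" "k \<le> n"
  shows "val q (shift n c) < 1"
  using \<open>k \<le> n\<close>
proof (induction n rule: dec_induct)
  case base
  show "val q (shift k c) < 1"
    by fact
next
  case (step n)
  have IH: "val q (shift n c) < 1"
    by (rule step.IH)
  have digs: "c \<in> digits M"
    using c by (simp add: univoque_seqs_def)
  show "val q (shift (Suc n) c) < 1"
  proof (cases "c n < M")
    case True
    then show ?thesis
      using c unfolding univoque_seqs_def by blast
  next
    case False
    then have "c n = M"
      using digitsD(2)[OF digs, of n] by simp
    then have "q * val q (shift n c) = of_int M + val q (shift (Suc n) c)"
      using val_Suc[OF q(1) digs, of n] q by simp
    moreover have "q * val q (shift n c) < q"
      using IH q by simp
    ultimately show ?thesis
      using q by linarith
  qed
qed

lemma val_reflect_tails_lt_1: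
  assumes "1 < q" "q \<le> of_int M + 1" "c \<in> univoque_seqs M q"
    and "val q (reflect M (shift k c)) < 1" "k \<le> n"
  shows "val q (reflect M (shift n c)) < 1"
  using val_tails_lt_1[OF assms(1,2) univoque_seqs_reflect[OF assms(3)], of k n] assms(4,5)
  by (simp add: shift_reflect)

section \<open>The golden ratio and infinite families\<close>

lemma less_golden_ratio_iff:
  assumes "0 \<le> q"
  shows "golden_ratio < q \<longleftrightarrow> q + 1 < q\<^sup>2"
proof -
  have "golden_ratio < q \<longleftrightarrow> sqrt 5 < 2 * q - 1"
    by (auto simp: golden_ratio_def)
  also have "\<dots> \<longleftrightarrow> 0 < 2 * q - 1 \<and> 5 < (2 * q - 1)\<^sup>2"
  proof -
    have "sqrt 5 < y \<longleftrightarrow> 0 < y \<and> 5 < y\<^sup>2" for y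
    proof -
      have "sqrt 5 < y \<longleftrightarrow> 0 < y \<and> (sqrt 5)\<^sup>2 < y\<^sup>2"
        by (metis abs_of_nonneg less_eq_real_def less_le_trans not_less power2_less_imp_less
            power_strict_mono real_sqrt_ge_zero zero_le_numeral zero_less_numeral pos2)
      then show ?thesis by simp
    qed
    then show ?thesis .
  qed
  also have "(2 * q - 1)\<^sup>2 = 4 * (q\<^sup>2 - q) + 1"
    by (simp add: power2_eq_square algebra_simps)
  also have "0 < 2 * q - 1 \<and> 5 < 4 * (q\<^sup>2 - q) + 1 \<longleftrightarrow> q + 1 < q\<^sup>2"
  proof -
    have "0 < 2 * q - 1" if "q + 1 < q\<^sup>2"
    proof -
      have "q * 1 < q * q"
        using that by (simp add: power2_eq_square)
      then have "1 < q"
        using assms by (metis mult_le_cancel_left not_less)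
      then show ?thesis by simp
    qed
    then show ?thesis by auto
  qed
  finally show ?thesis .
qed

text \<open>A univoque sequence over \<open>{0, 1}\<close> that is not constant contains 01, up to reflection. If
  \<open>v\<close> is the value of the tail behind these two digits, then \<open>v < q - 1\<close> by the digit 0 and
  \<open>v > 1 / (q - 1) - 1\<close> by the digit 1, which forces \<open>q\<^sup>2 > q + 1\<close>.\<close>
lemma univoque_seqs_up_to_golden_ratio:
  assumes q: "1 < q" "q \<le> golden_ratio"
  shows "univoque_seqs 1 q = {\<lambda>_. 0, \<lambda>_. 1}"
proof (intro equalityI subsetI)
  have no_rise: False if c: "c \<in> univoque_seqs 1 q" and "c n = 0" "c (Suc n) = 1" for c n
  proof -
    define v where "v = val q (shift (Suc (Suc n)) c)"
    have digs: "c \<in> digits 1"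
      using c by (simp add: univoque_seqs_def)
    have "val q (shift (Suc n) c) < 1"
      using c that by (simp add: univoque_seqs_def)
    then have "v < q - 1"
      using val_Suc[OF q(1) digs, of "Suc n"] that q by (simp add: v_def field_simps)
    moreover have "val q (reflect 1 (shift (Suc (Suc n)) c)) < 1"
      using c that by (simp add: univoque_seqs_def)
    then have "1 / (q - 1) - v < 1"
      using val_reflect[OF q(1) digits_shift[OF digs]] by (simp add: v_def)
    ultimately have "1 / (q - 1) < q"
      by linarith
    then have "q + 1 < q\<^sup>2"
      using q by (simp add: field_simps power2_eq_square)
    then show False
      using less_golden_ratio_iff[of q] q by simp
  qed
  fix c
  assume c: "c \<in> univoque_seqs 1 q"
  then have "c i = 0 \<or> c i = 1" for i
    using digitsD[of c 1 i] by (auto simp: univoque_seqs_def)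
  moreover from this have "c (Suc i) = c i" for i
    using no_rise[OF c, of i] no_rise[OF univoque_seqs_reflect[OF c], of i]
    by (metis cancel_comm_monoid_add_class.diff_cancel diff_zero reflect_apply)
  then have "c i = c 0" for i
    by (induction i) auto
  then have "c = (\<lambda>_. c 0)"
    by (rule ext)
  ultimately show "c \<in> {\<lambda>_. 0, \<lambda>_. 1}"
    by (metis insertCI)
qed (use constant_univoque_seqs[of q 1] q in auto)

text \<open>Prefixing zeros to a univoque sequence of value less than 1.\<close>
lemma univoque_seqs_pad:
  assumes q: "1 < q" "0 < M" and d: "d \<in> univoque_seqs M q" "val q d < 1"
  shows "(\<lambda>i. if i < k then 0 else d (i - k)) \<in> univoque_seqs M q"
proof -
  define p where "p k = (\<lambda>i. if i < k then 0 else d (i - k))" for k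
  have digs: "d \<in> digits M"
    using d by (simp add: univoque_seqs_def)
  then have p_digs: "p k \<in> digits M" for k
    using q by (auto simp: p_def digits_def)
  have "val q (p k) = val q d / q ^ k" for k
    using val_split[OF q(1) p_digs, of k k] by (simp add: p_def shift_def)
  moreover have "val q d / q ^ k \<le> val q d" for k
    using divide_left_mono[of 1 "q ^ k" "val q d"] q val_nonneg[OF q(1) digs]
    by (simp add: one_le_power)
  ultimately have small: "val q (p k) < 1" for k
    using d(2) by (metis le_less_trans)
  have shift_p: "shift n (p k) = (if n \<le> k then p (k - n) else shift (n - k) d)" for n
    by (auto simp: p_def fun_eq_iff add.commute)
  have "p k \<in> univoque_seqs M q"
    unfolding univoque_seqs_def
  proof (intro CollectI conjI allI impI)
    fix n
    have "n - k < Suc n - k" "d (n - k) = p k n" if "k \<le> n"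
      using that by (auto simp: p_def)
    then have tail: "\<exists>m. p k n = d m \<and> shift (Suc n) (p k) = shift (Suc m) d" if "k \<le> n"
      using that shift_p[of "Suc n"] by (auto simp: Suc_diff_le intro!: exI[of _ "n - k"])
    show "val q (shift (Suc n) (p k)) < 1" if "p k n < M"
    proof (cases "k \<le> n")
      case True
      from tail[OF this] that d(1) show ?thesis
        unfolding univoque_seqs_def by (smt (verit) mem_Collect_eq)
    next
      case False
      then show ?thesis
        using small shift_p[of "Suc n"] by simp
    qed
    show "val q (reflect M (shift (Suc n) (p k))) < 1" if "0 < p k n"
    proof -
      have "k \<le> n"
        using that by (auto simp: p_def split: if_splits)
      from tail[OF this] that d(1) show ?thesis
        unfolding univoque_seqs_def by (smt (verit) mem_Collect_eq)
    qed
  qed (rule p_digs)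
  then show ?thesis
    by (simp add: p_def)
qed

lemma infinite_univoque_seqs:
  assumes "1 < q" "0 < M" "d \<in> univoque_seqs M q" "val q d < 1" "d 0 \<noteq> 0"
  shows "infinite (univoque_seqs M q)"
proof -
  define p where "p k = (\<lambda>i. if i < k then 0 else d (i - k))" for k
  have "k \<le> l" if "p k = p l" for k l
  proof (rule ccontr)
    assume "\<not> k \<le> l"
    then have "p k l = 0" "p l l = d 0"
      by (auto simp: p_def)
    then show False
      using that assms by simp
  qed
  then have "inj p"
    by (intro injI antisym) auto
  then have "infinite (range p)"
    by (simp add: range_inj_infinite)
  moreover have "range p \<subseteq> univoque_seqs M q"
    using univoque_seqs_pad[OF assms(1-4)] by (auto simp: p_def)
  ultimately show ?thesis
    by (rule infinite_super[rotated])
qed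

text \<open>Zeros followed by 101010\<open>\<dots>\<close>, whose value is \<open>q / (q\<^sup>2 - 1)\<close>.\<close>
lemma infinite_univoque_seqs_above_golden_ratio:
  assumes "1 < q" "golden_ratio < q"
  shows "infinite (univoque_seqs 1 q)"
proof -
  define d where "d i = (if even i then 1 else 0 :: int)" for i :: nat
  have digs: "d \<in> digits 1"
    by (auto simp: digits_def d_def)
  have per: "shift (Suc (Suc 0)) d = d"
    by (auto simp: d_def fun_eq_iff)
  have 1: "val q d = (1 + val q (shift 1 d)) / q" "val q (shift 1 d) = val q d / q"
    using val_Suc[OF assms(1) digs, of 0] val_Suc[OF assms(1) digs, of 1] per by (simp_all add: d_def)
  then have "val q d * (q\<^sup>2 - 1) = q"
    using assms by (simp add: field_simps power2_eq_square)
  moreover have q2: "q + 1 < q\<^sup>2"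
    using assms less_golden_ratio_iff[of q] by simp
  moreover have "val q d * (q\<^sup>2 - 1) \<ge> 1 * (q\<^sup>2 - 1)" if "\<not> val q d < 1"
    using that q2 assms by (intro mult_right_mono) auto
  ultimately have d: "val q d < 1"
    by auto
  have tail: "shift n d = (if even n then d else shift 1 d)" for n
    by (auto simp: d_def fun_eq_iff)
  have refl: "reflect 1 d = shift 1 d" "reflect 1 (shift 1 d) = d"
    by (auto simp: d_def fun_eq_iff)
  have "d \<in> univoque_seqs 1 q"
    unfolding univoque_seqs_def
  proof (intro CollectI conjI allI impI)
    show "val q (shift (Suc n) d) < 1" if "d n < 1" for n
      using that d by (subst tail) (auto simp: d_def split: if_splits)
    show "val q (reflect 1 (shift (Suc n) d)) < 1" if "0 < d n" for n
      using that d refl by (subst tail) (auto simp: d_def split: if_splits)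
  qed (rule digs)
  then show ?thesis
    using infinite_univoque_seqs[OF assms(1) _ _ d] by (simp add: d_def)
qed

text \<open>Zeros followed by 111\<open>\<dots>\<close>, whose value is \<open>1 / (q - 1)\<close>.\<close>
lemma infinite_univoque_seqs_above_2:
  assumes "2 < q"
  shows "infinite (univoque_seqs 2 q)"
proof (rule infinite_univoque_seqs)
  show "val q (\<lambda>_. 1) < 1"
    using assms by (simp add: val_const)
  moreover have "shift n (\<lambda>_. 1) = (\<lambda>_. 1)" "reflect 2 (\<lambda>_. 1) = (\<lambda>_. 1)" for n
    by (simp_all add: fun_eq_iff)
  ultimately show "(\<lambda>_. 1) \<in> univoque_seqs 2 q"
    by (simp add: univoque_seqs_def digits_def)
qed (use assms in auto)

section \<open>Lexicographic order and values\<close>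

text \<open>The (weak) lexicographic order, stated as: the digits at the first difference, if there is
  one, are in the right order.\<close>
definition lexle :: "(nat \<Rightarrow> int) \<Rightarrow> (nat \<Rightarrow> int) \<Rightarrow> bool" where
  "lexle c d \<longleftrightarrow> (\<forall>j. (\<forall>i<j. c i = d i) \<longrightarrow> c j \<le> d j)"

lemma lexleD: "lexle c d \<Longrightarrow> (\<And>i. i < j \<Longrightarrow> c i = d i) \<Longrightarrow> c j \<le> d j"
  by (simp add: lexle_def)

lemma lexle_refl [simp]: "lexle c c"
  by (simp add: lexle_def)

lemma lexle_if_less_0: "c 0 < d 0 \<Longrightarrow> lexle c d"
  unfolding lexle_def by (metis gr0I less_imp_le order_less_irrefl)

lemma lexle_first_difference:
  assumes "lexle c d" "c n \<noteq> d n"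
  obtains j where "j \<le> n" "\<And>i. i < j \<Longrightarrow> c i = d i" "c j < d j"
proof -
  define j where "j = (LEAST i. c i \<noteq> d i)"
  have "c j \<noteq> d j" "\<And>i. i < j \<Longrightarrow> c i = d i" "j \<le> n"
    unfolding j_def using LeastI[of "\<lambda>i. c i \<noteq> d i", OF assms(2)] not_less_Least
      Least_le[of "\<lambda>i. c i \<noteq> d i", OF assms(2)] by auto
  then show ?thesis
    using that[of j] lexleD[OF assms(1), of j] by force
qed

text \<open>A sequence has value at most 1 if all its tails are lexicographically at most some
  sequence \<open>b\<close> of value at most 1. At the first difference the digit is smaller by at least
  1, so an excess of some tail over 1 is inherited, multiplied by at least \<open>q\<close>, by a later
  tail; but the values of tails are bounded.\<close>
lemma val_le_1_if_lexle:
  assumes q: "1 < q" and c: "c \<in> digits M" and b: "b \<in> digits M" "val q b \<le> 1"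
    and le: "\<And>k. lexle (shift k c) b"
  shows "val q c \<le> 1"
proof -
  define K where "K = real_of_int M / (q - 1)"
  have K: "0 \<le> K"
    using q digitsD[OF c, of 0] by (simp add: K_def)
  \<comment> \<open>The excess over 1 is bounded by \<open>K\<close>, and the recursion divides the bound by \<open>q\<close>.\<close>
  have bound: "val q (shift k c) \<le> 1 + K / q ^ n" for k n
  proof (induction n arbitrary: k)
    case 0
    have "val q (shift k c) \<le> K"
      unfolding K_def by (rule val_le[OF q digits_shift[OF c]])
    then show "val q (shift k c) \<le> 1 + K / q ^ 0"
      by simp
  next
    case (Suc n)
    show "val q (shift k c) \<le> 1 + K / q ^ Suc n"
    proof (cases "shift k c = b")
      case True
      then show ?thesis
        using b K q by (simp add: add_increasing2)
    next
      case False
      then obtain i where "shift k c i \<noteq> b i"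
        by (meson ext)
      from le this obtain j where j: "\<And>i. i < j \<Longrightarrow> shift k c i = b i" "shift k c j < b j"
        using lexle_first_difference by metis
      have "val q (shift (Suc j) (shift k c)) \<le> 1 + K / q ^ n"
        unfolding shift_shift by (rule Suc.IH)
      moreover have "real_of_int (shift k c j - b j) \<le> -1" "0 \<le> val q (shift (Suc j) b)"
        using j b q by (auto intro!: val_nonneg)
      ultimately have "real_of_int (shift k c j - b j) + val q (shift (Suc j) (shift k c))
          - val q (shift (Suc j) b) \<le> K / q ^ n"
        by linarith
      then have "(real_of_int (shift k c j - b j) + val q (shift (Suc j) (shift k c))
          - val q (shift (Suc j) b)) / q ^ Suc j \<le> K / q ^ n / q ^ Suc j"
        using q by (intro divide_right_mono) auto
      also have "\<dots> \<le> K / q ^ n / q"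
        using q K by (intro divide_left_mono) (auto simp: one_le_power)
      also have "\<dots> = K / q ^ Suc n"
        by simp
      finally show ?thesis
        using val_diff[OF q b(1) digits_shift[OF c], of j k, OF j(1)] b(2) by linarith
    qed
  qed
  have "(\<lambda>n. 1 + K * (1 / q) ^ n) \<longlonglongrightarrow> 1 + K * 0"
    using q by (intro tendsto_intros LIMSEQ_power_zero) auto
  then have "(\<lambda>n. 1 + K / q ^ n) \<longlonglongrightarrow> 1"
    by (simp add: power_divide)
  moreover have "val q c \<le> 1 + K / q ^ n" for n
    using bound[of 0 n] by simp
  ultimately show ?thesis
    by (intro LIMSEQ_le_const) auto
qed

text \<open>The inequality is strict for a sequence other than \<open>b\<close>, provided that \<open>b\<close> has
  infinitely many nonzero digits.\<close>
lemma val_lt_1_if_lexle: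
  assumes q: "1 < q" and c: "c \<in> digits M" and b: "b \<in> digits M" "val q b \<le> 1"
    and le: "\<And>k. lexle (shift k c) b"
    and inf: "\<And>n. \<exists>i\<ge>n. b i \<noteq> 0" and ne: "c \<noteq> b"
  shows "val q c < 1"
proof -
  obtain i where "c i \<noteq> b i"
    using ne by (meson ext)
  moreover have "lexle c b"
    using le[of 0] by simp
  ultimately obtain j where j: "\<And>i. i < j \<Longrightarrow> c i = b i" "c j < b j"
    using lexle_first_difference by metis
  obtain i where i: "i \<ge> Suc j" "b i \<noteq> 0"
    using inf by blast
  have "val q (shift (Suc j) c) \<le> 1"
    using le by (intro val_le_1_if_lexle[OF q digits_shift[OF c] b]) simp
  moreover have "0 < val q (shift (Suc j) b)"
    using i by (intro val_pos[OF q digits_shift[OF b(1)], of _ "i - Suc j"]) simp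
  moreover have "real_of_int (c j - b j) \<le> -1"
    using j by simp
  ultimately have "(real_of_int (c j - b j) + val q (shift (Suc j) c)
      - val q (shift (Suc j) b)) / q ^ Suc j < 0"
    using q by (intro divide_neg_pos) auto
  then show ?thesis
    using val_diff[OF q b(1) c, of j] j(1) b(2) by simp
qed

text \<open>Conversely, the order of values determines the lexicographic order relative to a sequence
  whose tails behind digits less than \<open>M\<close> have value at most 1.\<close>
lemma lexle_if_val_less:
  assumes q: "1 < q" and c: "c \<in> digits M" and b: "b \<in> digits M"
    and tails: "\<And>j. b j < M \<Longrightarrow> val q (shift (Suc j) b) \<le> 1"
    and less: "val q c < val q b"
  shows "lexle c b"
  unfolding lexle_def
proof (intro allI impI)
  fix j
  assume eq: "\<forall>i<j. c i = b i"
  show "c j \<le> b j"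
  proof (rule ccontr)
    assume gt: "\<not> c j \<le> b j"
    then have "b j < M"
      using digitsD[OF c, of j] by simp
    then have "val q (shift (Suc j) b) \<le> 1"
      by (rule tails)
    moreover have "1 \<le> real_of_int (c j - b j)" "0 \<le> val q (shift (Suc j) c)"
      using gt c q by (auto intro!: val_nonneg)
    ultimately have "0 \<le> (real_of_int (c j - b j) + val q (shift (Suc j) c)
        - val q (shift (Suc j) b)) / q ^ Suc j"
      using q by (intro divide_nonneg_pos) auto
    then show False
      using val_diff[OF q b c, of j] eq less by simp
  qed
qed

section \<open>Cardinalities\<close>

lemma countable_eventually_shift_eq: "countable {c. \<exists>k. shift k c = d}"
proof -
  have "{c. \<exists>k. shift k c = d} \<subseteq> range (\<lambda>xs i. if i < length xs then xs ! i else d (i - length xs))"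
  proof clarify
    fix c k
    assume "d = shift k c"
    then have "c = (\<lambda>i. if i < length (map c [0..<k]) then map c [0..<k] ! i
        else shift k c (i - length (map c [0..<k])))"
      by (auto simp: fun_eq_iff)
    then show "c \<in> range (\<lambda>xs i. if i < length xs then xs ! i else shift k c (i - length xs))"
      by (rule range_eqI)
  qed
  then show ?thesis
    by (rule countable_subset) simp
qed

lemma reals_lepoll_nat_sets: "(UNIV :: real set) \<lesssim> (UNIV :: nat set set)"
proof -
  \<comment> \<open>Dedekind cuts, with the rationals enumerated by natural numbers.\<close>
  define f where "f x = {n. real_of_rat (from_nat n) < x}" for x
  have "x \<le> y" if "f x = f y" for x y
  proof (rule ccontr)
    assume "\<not> x \<le> y"
    then obtain r where r: "y < real_of_rat r" "real_of_rat r < x"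
      using of_rat_dense[of y x] by auto
    then have "to_nat r \<in> f x" "to_nat r \<notin> f y"
      by (auto simp: f_def)
    then show False
      using that by simp
  qed
  then have "inj f"
    by (intro injI antisym) auto
  then show ?thesis
    unfolding lepoll_def by (intro exI[of _ f]) simp
qed

lemma univoque_numbers_eqpoll_nat_sets:
  fixes C :: "nat set \<Rightarrow> nat \<Rightarrow> int"
  assumes q: "1 < q" "of_int M < q" "q \<le> of_int M + 1"
    and C: "inj C" "\<And>e. C e \<in> univoque_seqs M q"
  shows "univoque_numbers q \<approx> (UNIV :: nat set set)"
proof (rule lepoll_antisym)
  show "univoque_numbers q \<lesssim> (UNIV :: nat set set)"
    by (rule lepoll_trans[OF subset_imp_lepoll reals_lepoll_nat_sets]) simp
  have "inj (\<lambda>e. val q (C e))"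
  proof (rule injI)
    fix e e'
    assume "val q (C e) = val q (C e')"
    moreover have "C e \<in> digits M"
      using C(2) by (simp add: univoque_seqs_def)
    ultimately have "C e = C e'"
      using univoque_seqs_unique[OF q(1) C(2)] by blast
    then show "e = e'"
      using C(1) by (simp add: inj_eq)
  qed
  moreover have "range (\<lambda>e. val q (C e)) \<subseteq> univoque_numbers q"
    using C(2) univoque_numbers_eq[OF q] by auto
  ultimately show "(UNIV :: nat set set) \<lesssim> univoque_numbers q"
    unfolding lepoll_def by blast
qed

lemma univoque_numbers_eqpoll_nat:
  assumes q: "1 < q" "of_int M < q" "q \<le> of_int M + 1"
    and "infinite (univoque_seqs M q)" "countable (univoque_seqs M q)"
  shows "univoque_numbers q \<approx> (UNIV :: nat set)"
proof -
  have "inj_on (val q) (univoque_seqs M q)"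
    using univoque_seqs_unique[OF q(1)] by (intro inj_onI) (auto simp: univoque_seqs_def)
  then have "univoque_seqs M q \<approx> univoque_numbers q"
    unfolding univoque_numbers_eq[OF q] eqpoll_def by (metis bij_betw_imageI)
  moreover have "univoque_seqs M q \<approx> (UNIV :: nat set)"
    unfolding eqpoll_def using to_nat_on_infinite[OF assms(5,4)] by blast
  ultimately show ?thesis
    by (metis eqpoll_sym eqpoll_trans)
qed

text \<open>For \<open>M \<ge> 3\<close> every sequence over \<open>{1, \<dots>, M - 1}\<close> is univoque, since the values of
  its tails and of their reflections are at most \<open>(M - 1) / (q - 1) < 1\<close>.\<close>
lemma univoque_numbers_eqpoll_above_3:
  assumes "3 < q"
  shows "univoque_numbers q \<approx> (UNIV :: nat set set)"
proof -
  define M where "M = \<lceil>q\<rceil> - 1"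
  have q: "1 < q" "of_int M < q" "q \<le> of_int M + 1" and "3 \<le> M"
    using assms unfolding M_def by linarith+
  define C :: "nat set \<Rightarrow> nat \<Rightarrow> int" where "C e i = (if i \<in> e then 1 else 2)" for e i
  have "inj C"
    by (rule injI) (auto simp: C_def fun_eq_iff set_eq_iff split: if_splits)
  have small: "val q c < 1" if "c \<in> digits (M - 1)" for c
  proof -
    have "val q c \<le> of_int (M - 1) / (q - 1)"
      by (rule val_le[OF q(1) that])
    also have "\<dots> < 1"
      using q by simp
    finally show ?thesis .
  qed
  have "C e \<in> univoque_seqs M q" for e
    unfolding univoque_seqs_def
    using \<open>3 \<le> M\<close> by (auto intro!: small simp: digits_def C_def)
  then show ?thesis
    by (intro univoque_numbers_eqpoll_nat_sets[OF q \<open>inj C\<close>])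
qed

section \<open>Critical bases\<close>

text \<open>The combinatorial input shared by the two alphabets. The sequence \<open>\<beta>\<close> is built from blocks
  by doubling: if \<open>w\<close> is its prefix of length \<open>2\<^sup>n\<close>, the next \<open>2\<^sup>n\<close> digits are the reflection
  of \<open>w\<close> with the last digit increased by 1. It belongs to a family \<open>C\<close> of sequences, indexed
  injectively by the sets of natural numbers, whose tails and reflected tails are all at most
  \<open>\<beta>\<close>, and different from \<open>\<beta>\<close> unless they start at position 0.\<close>
locale critical_family =
  fixes M :: int and C :: "nat set \<Rightarrow> nat \<Rightarrow> int" and \<beta> :: "nat \<Rightarrow> int"
  assumes M: "M = 1 \<or> M = 2"
    and \<beta>_def: "\<beta> = C UNIV"
    and C_digits: "C e \<in> digits M"
    and inj_C: "inj C"
    and shift_C_le: "lexle (shift k (C e)) \<beta>"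
    and reflect_C_le: "lexle (reflect M (shift k (C e))) \<beta>"
    and shift_C_ne: "0 < k \<Longrightarrow> shift k (C e) \<noteq> \<beta>"
    and reflect_C_ne: "0 < k \<Longrightarrow> reflect M (shift k (C e)) \<noteq> \<beta>"
    and beta_0: "\<beta> 0 = M"
    and beta_block: "i < 2 ^ n - 1 \<Longrightarrow> \<beta> (2 ^ n + i) = M - \<beta> i"
    and beta_last: "\<beta> (2 ^ Suc n - 1) = M - \<beta> (2 ^ n - 1) + 1"
begin

lemma beta_digits: "\<beta> \<in> digits M"
  by (simp add: \<beta>_def C_digits)

lemma beta_last_pos: "0 < \<beta> (2 ^ n - 1)"
proof (cases n)
  case 0
  then show ?thesis
    using M beta_0 by auto
next
  case (Suc m)
  then show ?thesis
    using beta_last[of m] digitsD(2)[OF beta_digits, of "2 ^ m - 1"] by simp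
qed

lemma beta_infinitely_often_nonzero: "\<exists>i\<ge>n. \<beta> i \<noteq> 0"
proof (intro exI conjI)
  show "n \<le> 2 ^ n - 1"
    using less_exp[of n] by linarith
  show "\<beta> (2 ^ n - 1) \<noteq> 0"
    using beta_last_pos[of n] by simp
qed

lemma beta_1: "\<beta> (Suc 0) = 1"
  using beta_last[of 0] beta_0 by (simp add: numeral_2_eq_2)

lemma beta_2: "\<beta> 2 = 0"
  using beta_block[of 0 1] beta_0 by simp

lemma ex_critical_base: "\<exists>p. of_int M < p \<and> p < of_int M + 1 \<and> val p \<beta> = 1"
proof -
  define q0 where "q0 = of_int M + 1 / (of_int M + 1 :: real)"
  define f where "f q = (1 / q) * (\<Sum>i. of_int (\<beta> i) * (1 / q) ^ i)" for q :: real
  have q0: "1 < q0" "of_int M < q0" "q0 \<le> of_int M + 1"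
    using M by (auto simp: q0_def)
  have sum: "summable (\<lambda>i. of_int (\<beta> i) * (1 / q) ^ i)" if "1 < q" for q :: real
  proof -
    have "summable (\<lambda>i. q * (of_int (\<beta> i) / q ^ Suc i))"
      using summable_val[OF that beta_digits] by (rule summable_mult)
    moreover have "(\<lambda>i. q * (of_int (\<beta> i) / q ^ Suc i)) = (\<lambda>i. of_int (\<beta> i) * (1 / q) ^ i)"
      using that by (auto simp: power_divide)
    ultimately show ?thesis
      by simp
  qed
  have f: "f q = val q \<beta>" if "1 < q" for q
    unfolding f_def val_def suminf_mult[OF sum[OF that], symmetric]
    by (simp add: power_divide)
  have cont: "isCont f q" if q: "1 < q" for q
  proof -
    obtain r where r: "1 < r" "r < q"
      using dense[OF q] by blast
    have "isCont (\<lambda>x. \<Sum>i. of_int (\<beta> i) * (1 / x) ^ i) q"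
    proof (rule isCont_powser'[where K = "1 / r"])
      show "isCont ((/) 1) q"
        using that by (intro continuous_intros) auto
      show "norm (1 / q) < norm (1 / r)"
        using r by (simp add: field_simps)
    qed (use sum r in simp)
    then show ?thesis
      unfolding f_def using that by (intro continuous_intros) auto
  qed
  \<comment> \<open>The base \<open>q0\<close> is so close to \<open>M\<close> that the first two digits \<open>M\<close> and 1 suffice.\<close>
  have "1 \<le> of_int M / q0 + 1 / q0 ^ 2"
    using M by (auto simp: q0_def field_simps power2_eq_square)
  also have "\<dots> \<le> val q0 \<beta>"
    using val_split[OF q0(1) beta_digits, of 2] val_nonneg[OF q0(1) digits_shift[OF beta_digits], of 2]
      q0 beta_0 beta_1 by (simp add: numeral_2_eq_2)
  finally have "1 \<le> f q0"
    using f q0 by simp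
  moreover have "f (of_int M + 1) \<le> 1"
    using M f[of "of_int M + 1"] val_le[of "of_int M + 1", OF _ beta_digits] by auto
  ultimately obtain p where p: "q0 \<le> p" "p \<le> of_int M + 1" "f p = 1"
    using IVT2[of f "of_int M + 1" 1 q0] q0 cont by (smt (verit, best))
  have "val p \<beta> = 1"
    using f[of p] p q0 by simp
  moreover have "p \<noteq> of_int M + 1"
  proof
    assume "p = of_int M + 1"
    then have "val p (reflect M \<beta>) = 0"
      using val_reflect[of p, OF _ beta_digits] p(1) q0 \<open>val p \<beta> = 1\<close> M by auto
    moreover have "0 < val p (reflect M \<beta>)"
      using p q0 M beta_2 by (intro val_pos[OF _ digits_reflect[OF beta_digits], of _ 2]) auto
    ultimately show False
      by simp
  qed
  ultimately show ?thesis
    using p q0 by (intro exI[of _ p]) auto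
qed

text \<open>The base in which \<open>\<beta>\<close> is an expansion of 1 (unique because \<open>val q \<beta>\<close> is strictly
  decreasing in \<open>q\<close>; any choice would do for the definition).\<close>
definition critical_base :: real where
  "critical_base = (SOME p. of_int M < p \<and> p < of_int M + 1 \<and> val p \<beta> = 1)"

lemma critical_base: "of_int M < critical_base" "critical_base < of_int M + 1"
  "val critical_base \<beta> = 1" "1 < critical_base"
  using someI_ex[OF ex_critical_base] M by (auto simp: critical_base_def)

lemma C_univoque: "C e \<in> univoque_seqs M critical_base"
  unfolding univoque_seqs_def
proof (intro CollectI conjI allI impI)
  fix n
  show "val critical_base (shift (Suc n) (C e)) < 1"
    using critical_base shift_C_le shift_C_ne[of "Suc n" e]
    by (intro val_lt_1_if_lexle[OF _ digits_shift[OF C_digits] beta_digits])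
      (auto intro: beta_infinitely_often_nonzero)
  show "val critical_base (reflect M (shift (Suc n) (C e))) < 1"
    using critical_base reflect_C_le reflect_C_ne[of "Suc n" e]
    by (intro val_lt_1_if_lexle[OF _ digits_reflect[OF digits_shift[OF C_digits]] beta_digits])
      (auto intro: beta_infinitely_often_nonzero simp: shift_reflect)
qed (rule C_digits)

lemma lexle_beta_below:
  assumes q: "1 < q" "q < critical_base" and c: "c \<in> digits M" "val q c \<le> 1"
  shows "lexle c \<beta>"
proof (rule lexle_if_val_less[OF critical_base(4) c(1) beta_digits])
  show "val critical_base (shift (Suc j) \<beta>) \<le> 1" if "\<beta> j < M" for j
    using C_univoque[of UNIV] that by (auto simp: univoque_seqs_def \<beta>_def less_imp_le)
  show "val critical_base c < val critical_base \<beta>"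
  proof (cases "\<exists>i. c i \<noteq> 0")
    case True
    then show ?thesis
      using val_strict_mono_base[OF q c(1)] c(2) critical_base by fastforce
  next
    case False
    then show ?thesis
      using critical_base by (simp add: val_def)
  qed
qed

text \<open>Below the critical base a finite prefix of \<open>\<beta>\<close> already has value greater than 1, and its
  length can be taken to be a power of 2.\<close>
lemma beta_prefix_too_large_below:
  assumes q: "1 < q" "q < critical_base"
  obtains n where "\<And>c. c \<in> digits M \<Longrightarrow> val q c \<le> 1 \<Longrightarrow> \<exists>i<2 ^ n. c i \<noteq> \<beta> i"
proof -
  have "1 < val q \<beta>"
    using val_strict_mono_base[OF q beta_digits, of 0] beta_0 M critical_base by auto
  moreover have "(\<lambda>n. \<Sum>i<n. of_int (\<beta> i) / q ^ Suc i) \<longlonglongrightarrow> val q \<beta>"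
    unfolding val_def by (rule summable_LIMSEQ[OF summable_val[OF q(1) beta_digits]])
  ultimately have "\<forall>\<^sub>F n in sequentially. 1 < (\<Sum>i<n. of_int (\<beta> i) / q ^ Suc i)"
    by (rule order_tendstoD(1)[rotated])
  then obtain n where n: "1 < (\<Sum>i<n. of_int (\<beta> i) / q ^ Suc i)"
    using eventually_happens'[OF sequentially_bot] by blast
  have "\<exists>i<2 ^ n. c i \<noteq> \<beta> i" if "c \<in> digits M" "val q c \<le> 1" for c
  proof (rule ccontr)
    assume "\<not> (\<exists>i<2 ^ n. c i \<noteq> \<beta> i)"
    then have "c i = \<beta> i" if "i < n" for i
      using that less_exp[of n] by (meson less_trans)
    then have "(\<Sum>i<n. of_int (c i) / q ^ Suc i) = (\<Sum>i<n. of_int (\<beta> i) / q ^ Suc i)"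
      by (intro sum.cong) auto
    moreover have "0 \<le> val q (shift n c) / q ^ n"
      using q that by (intro divide_nonneg_pos val_nonneg[of _ _ M]) auto
    ultimately show False
      using val_split[OF q(1) that(1), of n] that(2) n by linarith
  qed
  then show ?thesis
    using that by blast
qed

text \<open>All tails and reflected tails are at most \<open>\<beta>\<close>, and none of them starts with the prefix of
  \<open>\<beta>\<close> of length \<open>2\<^sup>n\<close>.\<close>
definition tame :: "nat \<Rightarrow> (nat \<Rightarrow> int) \<Rightarrow> bool" where
  "tame n c \<longleftrightarrow> (\<forall>k. lexle (shift k c) \<beta> \<and> lexle (reflect M (shift k c)) \<beta> \<and>
     (\<exists>i<2 ^ n. shift k c i \<noteq> \<beta> i) \<and> (\<exists>i<2 ^ n. reflect M (shift k c) i \<noteq> \<beta> i))"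

lemma tame_shift: "tame n c \<Longrightarrow> tame n (shift k c)"
  unfolding tame_def shift_shift by blast

lemma tame_reflect: "tame n c \<Longrightarrow> tame n (reflect M c)"
  unfolding tame_def shift_reflect reflect_reflect by blast

text \<open>The block of order \<open>n\<close> is the prefix of \<open>\<beta>\<close> of length \<open>2\<^sup>n\<close>.\<close>
definition starts_with_block :: "nat \<Rightarrow> (nat \<Rightarrow> int) \<Rightarrow> bool" where
  "starts_with_block n c \<longleftrightarrow> (\<forall>i<2 ^ n. c i = \<beta> i)"

text \<open>The key step. Let \<open>c\<close> start with the block \<open>w\<close> of order \<open>n\<close>. The next \<open>2\<^sup>n\<close> digits
  are at most the continuation of \<open>w\<close> in \<open>\<beta>\<close>, which is the reflection of \<open>w\<close> with its last
  digit increased by 1, and they cannot be equal to it. On the other hand they are at least the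
  reflection of \<open>w\<close>, because the reflected tail is at most \<open>\<beta>\<close>. Hence they are the reflection
  of \<open>w\<close>.\<close>
lemma block_forces_reflected_block:
  assumes tame: "tame (Suc n) c" and block: "starts_with_block n c"
  shows "starts_with_block n (reflect M (shift (2 ^ n) c))"
proof -
  have le: "lexle c \<beta>" and ne: "\<exists>i<2 ^ Suc n. c i \<noteq> \<beta> i"
    using tame[unfolded tame_def, rule_format, of 0] by simp_all
  have refl: "lexle (reflect M (shift (2 ^ n) c)) \<beta>"
    using tame by (simp add: tame_def)
  have "i < 2 ^ n \<longrightarrow> M - c (2 ^ n + i) = \<beta> i" for i
  proof (induction i rule: less_induct)
    case (less i)
    show ?case
    proof
      assume i: "i < 2 ^ n"
      have prev: "M - c (2 ^ n + j) = \<beta> j" if "j < i" for j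
        using less[OF that] that i by simp
      have agree: "c j = \<beta> j" if "j < 2 ^ n + i" for j
      proof (cases "j < 2 ^ n")
        case True
        then show ?thesis
          using block by (simp add: starts_with_block_def)
      next
        case False
        then have j: "j = 2 ^ n + (j - 2 ^ n)" "j - 2 ^ n < i"
          using that by auto
        then have "c j = M - \<beta> (j - 2 ^ n)"
          using prev[of "j - 2 ^ n"] by simp
        also have "\<dots> = \<beta> j"
          using beta_block[of "j - 2 ^ n" n] i j by simp
        finally show ?thesis .
      qed
      have lower: "M - c (2 ^ n + i) \<le> \<beta> i"
        using lexleD[OF refl, of i] prev by simp
      have upper: "c (2 ^ n + i) \<le> \<beta> (2 ^ n + i)"
        using lexleD[OF le, of "2 ^ n + i"] agree by simp
      \<comment> \<open>Only at the last digit of the block do the two bounds differ, and there by 1.\<close>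
      show "M - c (2 ^ n + i) = \<beta> i"
      proof (cases "i < 2 ^ n - 1")
        case True
        then show ?thesis
          using lower upper beta_block[of i n] by simp
      next
        case False
        then have last: "i = 2 ^ n - 1" "2 ^ n + i = 2 ^ Suc n - 1"
          using i by auto
        have "c (2 ^ n + i) \<noteq> \<beta> (2 ^ n + i)"
        proof
          assume "c (2 ^ n + i) = \<beta> (2 ^ n + i)"
          then have "c j = \<beta> j" if "j < 2 ^ Suc n" for j
            using agree[of j] that last by (cases "j = 2 ^ n + i") auto
          then show False
            using ne by blast
        qed
        then show ?thesis
          using lower upper beta_last[of n] last by simp
      qed
    qed
  qed
  then show ?thesis
    by (simp add: starts_with_block_def)
qed

text \<open>The block of order \<open>n\<close> and its reflection, alternating forever.\<close>
definition periodic_seq :: "nat \<Rightarrow> nat \<Rightarrow> int" where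
  "periodic_seq n i = (let r = i mod 2 ^ Suc n in if r < 2 ^ n then \<beta> r else M - \<beta> (r - 2 ^ n))"

lemma block_forces_periodic:
  assumes "tame (Suc n) c" "starts_with_block n c"
  shows "c = periodic_seq n"
proof -
  have next_block: "starts_with_block n (shift (2 ^ Suc n) c)"
    if "tame (Suc n) c" "starts_with_block n c" for c
    using block_forces_reflected_block[OF tame_reflect[OF tame_shift[OF that(1), of "2 ^ n"]]]
      block_forces_reflected_block[OF that] by (simp add: shift_reflect mult_2)
  have blocks: "starts_with_block n (shift (m * 2 ^ Suc n) c)" for m
  proof (induction m)
    case (Suc m)
    have "starts_with_block n (shift (2 ^ Suc n) (shift (m * 2 ^ Suc n) c))"
      by (rule next_block[OF tame_shift[OF assms(1)] Suc])
    then show "starts_with_block n (shift (Suc m * 2 ^ Suc n) c)"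
      by (simp only: shift_shift mult_Suc add.commute)
  qed (use assms in simp)
  show ?thesis
  proof
    fix i :: nat
    define m r where "m = i div 2 ^ Suc n" and "r = i mod 2 ^ Suc n"
    have i: "i = m * 2 ^ Suc n + r" and r: "r < 2 ^ Suc n"
      unfolding m_def r_def by (simp_all only: div_mult_mod_eq mod_less_divisor zero_less_power pos2)
    define d where "d = shift (m * 2 ^ Suc n) c"
    have d: "c i = d r"
      unfolding i d_def by simp
    show "c i = periodic_seq n i"
    proof (cases "r < 2 ^ n")
      case True
      then show ?thesis
        using blocks[of m] unfolding d periodic_seq_def r_def[symmetric]
        by (simp add: starts_with_block_def d_def Let_def)
    next
      case False
      then have "r - 2 ^ n < 2 ^ n"
        using r by auto
      moreover have "starts_with_block n (reflect M (shift (2 ^ n) d))"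
        unfolding d_def by (rule block_forces_reflected_block[OF tame_shift[OF assms(1)] blocks])
      ultimately have "M - d (2 ^ n + (r - 2 ^ n)) = \<beta> (r - 2 ^ n)"
        unfolding starts_with_block_def reflect_apply shift_apply by blast
      then show ?thesis
        using False unfolding d periodic_seq_def r_def[symmetric] by (simp add: Let_def)
    qed
  qed
qed

text \<open>By induction on \<open>n\<close>: a sequence that is eventually tame of order \<open>n + 1\<close> is eventually
  periodic if it contains the block of order \<open>n\<close> or its reflection far enough out, and eventually
  tame of order \<open>n\<close> otherwise.\<close>
lemma countable_eventually_tame: "countable {c. \<exists>k. tame n (shift k c)}"
proof (induction n)
  case 0
  have "shift k c = (\<lambda>_. 1)" if "tame 0 (shift k c)" for k c
  proof
    fix i
    have "lexle (shift (k + i) c) \<beta>" "lexle (reflect M (shift (k + i) c)) \<beta>"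
      "c (k + i) \<noteq> M" "M - c (k + i) \<noteq> M"
      using that[unfolded tame_def, rule_format, of i] beta_0 by auto
    moreover from this have "c (k + i) \<le> M" "M - c (k + i) \<le> M"
      using lexleD[of _ \<beta> 0] beta_0 by fastforce+
    ultimately show "shift k c i = 1"
      using M by auto
  qed
  then have "{c. \<exists>k. tame 0 (shift k c)} \<subseteq> {c. \<exists>k. shift k c = (\<lambda>_. 1)}"
    by blast
  then show ?case
    using countable_eventually_shift_eq countable_subset by blast
next
  case (Suc n)
  have "\<exists>l. shift l c = periodic_seq n \<or> shift l c = reflect M (periodic_seq n) \<or> tame n (shift l c)"
    if t: "tame (Suc n) (shift k c)" for k c
  proof (cases "\<exists>m. starts_with_block n (shift m (shift k c))
      \<or> starts_with_block n (reflect M (shift m (shift k c)))")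
    case True
    then obtain m where "starts_with_block n (shift m (shift k c))
        \<or> starts_with_block n (reflect M (shift m (shift k c)))"
      by blast
    then show ?thesis
    proof
      assume "starts_with_block n (shift m (shift k c))"
      from block_forces_periodic[OF tame_shift[OF t] this] show ?thesis
        unfolding shift_shift by blast
    next
      assume "starts_with_block n (reflect M (shift m (shift k c)))"
      from block_forces_periodic[OF tame_reflect[OF tame_shift[OF t]] this] show ?thesis
        unfolding shift_shift reflect_eq_iff by blast
    qed
  next
    case False
    then have "tame n (shift k c)"
      using t unfolding tame_def starts_with_block_def by blast
    then show ?thesis
      by blast
  qed
  then have "{c. \<exists>k. tame (Suc n) (shift k c)} \<subseteq> {c. \<exists>k. shift k c = periodic_seq n}
      \<union> {c. \<exists>k. shift k c = reflect M (periodic_seq n)} \<union> {c. \<exists>k. tame n (shift k c)}"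
    by blast
  moreover have "countable ({c. \<exists>k. shift k c = periodic_seq n}
      \<union> {c. \<exists>k. shift k c = reflect M (periodic_seq n)} \<union> {c. \<exists>k. tame n (shift k c)})"
    by (intro countable_Un countable_eventually_shift_eq Suc)
  ultimately show ?case
    by (rule countable_subset)
qed

lemma countable_univoque_seqs_below:
  assumes q: "1 < q" "of_int M < q" "q < critical_base"
  shows "countable (univoque_seqs M q)"
proof -
  have qM: "q \<le> of_int M + 1"
    using q critical_base by simp
  obtain n where n: "\<And>c. c \<in> digits M \<Longrightarrow> val q c \<le> 1 \<Longrightarrow> \<exists>i<2 ^ n. c i \<noteq> \<beta> i"
    using beta_prefix_too_large_below[OF q(1,3)] by blast
  have "\<exists>k. tame n (shift k c)"
    if c: "c \<in> univoque_seqs M q" and ne: "c \<noteq> (\<lambda>_. 0)" "c \<noteq> (\<lambda>_. M)" for c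
  proof -
    have digs: "c \<in> digits M"
      using c by (simp add: univoque_seqs_def)
    obtain k0 k1 where "c k0 \<noteq> 0" "c k1 \<noteq> M"
      using ne unfolding fun_eq_iff by blast
    then have "0 < c k0" "c k1 < M"
      using digitsD[OF digs, of k0] digitsD[OF digs, of k1] by auto
    then have 1: "val q (reflect M (shift (Suc k0) c)) < 1" "val q (shift (Suc k1) c) < 1"
      using c unfolding univoque_seqs_def by blast+
    define K where "K = Suc k0 + Suc k1"
    have "val q (shift (K + k) c) < 1" for k
      by (rule val_tails_lt_1[OF q(1) qM c 1(2)]) (simp add: K_def)
    moreover have "val q (reflect M (shift (K + k) c)) < 1" for k
      by (rule val_reflect_tails_lt_1[OF q(1) qM c 1(1)]) (simp add: K_def)
    ultimately have "tame n (shift K c)"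
      unfolding tame_def shift_shift
      by (intro allI conjI lexle_beta_below[OF q(1,3)] n digits_shift digits_reflect digs less_imp_le)
    then show ?thesis
      by blast
  qed
  then have "univoque_seqs M q \<subseteq> {\<lambda>_. 0, \<lambda>_. M} \<union> {c. \<exists>k. tame n (shift k c)}"
    by blast
  moreover have "countable ({\<lambda>_. 0, \<lambda>_. M} \<union> {c. \<exists>k. tame n (shift k c)})"
    by (intro countable_Un countable_eventually_tame) simp
  ultimately show ?thesis
    by (rule countable_subset)
qed

text \<open>A unique expansion \<open>c\<close> of 1 in a base between \<open>M\<close> and the critical one would be lexicographically
  larger than all its later tails and reflected tails, and smaller than \<open>\<beta>\<close>. If \<open>m\<close> is the largest
  order for which \<open>c\<close> starts with the block, then \<open>c\<close> is tame of order \<open>m + 1\<close> and hence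
  periodic, so that one of its tails is \<open>c\<close> itself.\<close>
lemma no_univoque_base_below:
  assumes q: "1 < q" "of_int M < q" "q < critical_base"
    and c: "c \<in> univoque_seqs M q" "val q c = 1"
  shows False
proof -
  have qM: "q < of_int M + 1"
    using q critical_base by simp
  have digs: "c \<in> digits M"
    using c by (simp add: univoque_seqs_def)
  have val_c: "q = of_int (c 0) + val q (shift (Suc 0) c)"
    using val_Suc[OF q(1) digs, of 0] c(2) q(1) by (simp add: field_simps)
  have c0: "c 0 = M"
  proof (rule ccontr)
    assume "c 0 \<noteq> M"
    then have "c 0 < M"
      using digitsD(2)[OF digs, of 0] by simp
    then have "val q (shift (Suc 0) c) < 1" "real_of_int (c 0) + 1 \<le> of_int M"
      using c(1) unfolding univoque_seqs_def by (blast, linarith)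
    then show False
      using val_c q(2) by linarith
  qed
  have "val q (shift (Suc 0) c) < 1"
    using val_c c0 qM by simp
  then have tail: "val q (shift k c) < 1" if "0 < k" for k
    using val_tails_lt_1[OF q(1) less_imp_le[OF qM] c(1)] that by (simp add: Suc_le_eq)
  have "0 < c 0"
    using M c0 by auto
  then have "val q (reflect M (shift (Suc 0) c)) < 1"
    using c(1) unfolding univoque_seqs_def by blast
  then have rtail: "val q (reflect M (shift k c)) < 1" if "0 < k" for k
    using val_reflect_tails_lt_1[OF q(1) less_imp_le[OF qM] c(1)] that by (simp add: Suc_le_eq)
  have le_c: "lexle d c" if "d \<in> digits M" "val q d < 1" for d
    using that c(2) tail by (intro lexle_if_val_less[OF q(1) _ digs]) (auto simp: less_imp_le)
  have c_beta: "lexle c \<beta>"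
    using c by (intro lexle_beta_below[OF q(1,3) digs]) simp
  \<comment> \<open>\<open>D n\<close> says that \<open>c\<close> does not start with the block of order \<open>n\<close>.\<close>
  define D where "D n \<longleftrightarrow> (\<exists>i<2 ^ n. c i \<noteq> \<beta> i)" for n :: nat
  obtain n where "D n"
    using beta_prefix_too_large_below[OF q(1,3)] digs c(2) unfolding D_def by (metis order_refl)
  moreover have "\<not> D 0"
    using c0 beta_0 by (simp add: D_def)
  ultimately obtain m where m: "\<not> D m" "D (Suc m)"
    using ex_least_nat_less[of D n] by auto
  obtain l where "l < 2 ^ Suc m" "c l \<noteq> \<beta> l"
    using m by (auto simp: D_def)
  then obtain j where j: "j < 2 ^ Suc m" "\<And>i. i < j \<Longrightarrow> c i = \<beta> i" "c j < \<beta> j"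
    using lexle_first_difference[OF c_beta] by (metis le_less_trans)
  have disagree: "\<exists>i<2 ^ Suc m. d i \<noteq> \<beta> i" if "lexle d c" for d
  proof (rule ccontr)
    assume "\<not> (\<exists>i<2 ^ Suc m. d i \<noteq> \<beta> i)"
    then have "d i = \<beta> i" if "i \<le> j" for i
      using that j(1) by (meson le_less_trans)
    then have "d j \<le> c j" "d j = \<beta> j"
      using lexleD[OF that, of j] j(2) by auto
    then show False
      using j(3) by simp
  qed
  have "tame (Suc m) c"
    unfolding tame_def
  proof (intro allI conjI)
    fix k
    show "lexle (shift k c) \<beta>"
    proof (cases "k = 0")
      case False
      then show ?thesis
        using tail[of k] by (intro lexle_beta_below[OF q(1,3)] digits_shift digs) simp
    qed (simp add: c_beta)
    show "\<exists>i<2 ^ Suc m. shift k c i \<noteq> \<beta> i"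
    proof (rule disagree)
      show "lexle (shift k c) c"
      proof (cases "k = 0")
        case False
        then show ?thesis
          using tail by (intro le_c digits_shift digs) simp
      qed simp
    qed
    \<comment> \<open>The reflection of \<open>c\<close> itself starts with 0, so only proper tails need the bound on values.\<close>
    have first: "reflect M (shift 0 c) 0 < \<beta> 0" "reflect M (shift 0 c) 0 < c 0"
      using c0 beta_0 M by auto
    show "lexle (reflect M (shift k c)) \<beta>"
    proof (cases "k = 0")
      case True
      show ?thesis
        unfolding True by (rule lexle_if_less_0) (rule first)
    next
      case False
      then show ?thesis
        using rtail[of k]
        by (intro lexle_beta_below[OF q(1,3)] digits_reflect digits_shift digs less_imp_le) simp
    qed
    show "\<exists>i<2 ^ Suc m. reflect M (shift k c) i \<noteq> \<beta> i"
    proof (rule disagree, cases "k = 0")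
      case True
      show "lexle (reflect M (shift k c)) c"
        unfolding True by (rule lexle_if_less_0) (rule first)
    next
      case False
      then show "lexle (reflect M (shift k c)) c"
        using rtail[of k] by (intro le_c digits_reflect digits_shift digs) simp
    qed
  qed
  moreover have "starts_with_block m c"
    using m by (simp add: D_def starts_with_block_def)
  ultimately have "c = periodic_seq m"
    by (rule block_forces_periodic)
  \<comment> \<open>A proper tail has value less than 1, but \<open>c\<close> has value 1.\<close>
  then have "shift (2 ^ Suc m) c = c"
    by (simp add: fun_eq_iff periodic_seq_def)
  then show False
    using tail[of "2 ^ Suc m"] c(2) by simp
qed

lemma critical_base_univoque: "critical_base \<in> univoque_bases"
proof -
  have "1 \<in> univoque_numbers critical_base"
    using univoque_numbers_eq[of critical_base M] critical_base C_univoque[of UNIV]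
    by (auto simp: \<beta>_def)
  then show ?thesis
    using critical_base by (simp add: univoque_bases_def univoque_numbers_def)
qed

lemma critical_base_le:
  assumes "q \<in> univoque_bases" "of_int M < q"
  shows "critical_base \<le> q"
proof (rule ccontr)
  assume less: "\<not> critical_base \<le> q"
  have "1 < q" "1 \<in> univoque_numbers q"
    using assms by (simp_all add: univoque_bases_def univoque_numbers_def)
  then show False
    using univoque_numbers_eq[of q M] no_univoque_base_below[of q] less assms critical_base by auto
qed

lemma univoque_numbers_eqpoll_from_critical_base:
  assumes "critical_base \<le> q" "q \<le> of_int M + 1"
  shows "univoque_numbers q \<approx> (UNIV :: nat set set)"
  using assms critical_base univoque_seqs_mono_base[of critical_base q M] C_univoque inj_C
  by (intro univoque_numbers_eqpoll_nat_sets[where C = C and M = M]) auto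

end

section \<open>The two Thue--Morse families\<close>

lemma nat_parity_cases:
  fixes n :: nat
  obtains (zero) "n = 0" | (odd) i where "n = Suc (2 * i)" | (even) i where "n = Suc (Suc (2 * i))"
proof (cases n)
  case (Suc m)
  show ?thesis
  proof (cases "even m")
    case True
    then show ?thesis
      using Suc odd[of "m div 2"] by simp
  next
    case False
    then show ?thesis
      using Suc even[of "m div 2"] by simp
  qed
qed (use zero in simp)

text \<open>A family containing the truncated Thue--Morse sequence. Position \<open>n\<close> here is position
  \<open>n + 1\<close> in the usual numbering from 1, so the recursion reads \<open>c\<^sub>1 = [0 \<in> e]\<close>,
  \<open>c\<^sub>2\<^sub>i = c'\<^sub>i\<close> and \<open>c\<^sub>2\<^sub>i\<^sub>+\<^sub>1 = 1 - c'\<^sub>i\<close> with \<open>c'\<close> belonging to the set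
  \<open>{n. n + 1 \<in> e}\<close>. In other words \<open>c\<close> is the digit \<open>[0 \<in> e]\<close> followed by the image of \<open>c'\<close>
  under the Thue--Morse substitution 0 to 01, 1 to 10.\<close>
function thue_morse_seq :: "nat set \<Rightarrow> nat \<Rightarrow> int" where
  "thue_morse_seq e 0 = of_bool (0 \<in> e)"
| "thue_morse_seq e (Suc (2 * i)) = thue_morse_seq (Suc -` e) i"
| "thue_morse_seq e (Suc (Suc (2 * i))) = 1 - thue_morse_seq (Suc -` e) i"
proof -
  fix P and x :: "nat set \<times> nat"
  assume *: "\<And>e. x = (e, 0) \<Longrightarrow> P" "\<And>e i. x = (e, Suc (2 * i)) \<Longrightarrow> P"
    "\<And>e i. x = (e, Suc (Suc (2 * i))) \<Longrightarrow> P"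
  obtain e n where "x = (e, n)"
    by fastforce
  then show P
    using * by (cases n rule: nat_parity_cases) blast+
qed (auto | presburger)+
termination
  by (relation "measure snd") auto

abbreviation thue_morse :: "nat \<Rightarrow> int" where
  "thue_morse \<equiv> thue_morse_seq UNIV"

lemmas thue_morse_seq_odd = thue_morse_seq.simps(2)
lemmas thue_morse_seq_even = thue_morse_seq.simps(3)

declare thue_morse_seq_odd [simp del] thue_morse_seq_even [simp del]

lemma thue_morse_seq_range: "thue_morse_seq e n = 0 \<or> thue_morse_seq e n = 1"
  by (induction e n rule: thue_morse_seq.induct) (auto simp: thue_morse_seq.simps)

lemma thue_morse_1 [simp]: "thue_morse (Suc 0) = 1"
  using thue_morse_seq_odd[of UNIV 0] by simp

lemma thue_morse_seq_complement: "thue_morse_seq (- e) n = 1 - thue_morse_seq e n"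
  by (induction e n rule: thue_morse_seq.induct) (auto simp: thue_morse_seq.simps vimage_Compl)

lemma inj_thue_morse_seq: "inj thue_morse_seq"
proof (rule injI, rule set_eqI)
  fix e e' and n :: nat
  assume "thue_morse_seq e = thue_morse_seq e'"
  then show "n \<in> e \<longleftrightarrow> n \<in> e'"
  proof (induction n arbitrary: e e')
    case 0
    have "(of_bool (0 \<in> e) :: int) = of_bool (0 \<in> e')"
      using fun_cong[OF 0, of 0] by simp
    then show "0 \<in> e \<longleftrightarrow> 0 \<in> e'"
      by (simp only: of_bool_eq_iff)
  next
    case (Suc n)
    have "thue_morse_seq (Suc -` e) i = thue_morse_seq (Suc -` e') i" for i
      using fun_cong[OF Suc.prems, of "Suc (2 * i)"] by (simp add: thue_morse_seq_odd)
    then have "thue_morse_seq (Suc -` e) = thue_morse_seq (Suc -` e')"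
      by (rule ext)
    from Suc.IH[OF this] show ?case
      by simp
  qed
qed

text \<open>The digits at positions \<open>2 l + 1\<close> and \<open>2 l + 2\<close> form one of the words 01 and 10, whereas
  the truncated Thue--Morse sequence starts with 11.\<close>
lemma odd_tail_not_thue_morse:
  "thue_morse_seq e (Suc (2 * l)) = 1 \<Longrightarrow> thue_morse_seq e (Suc (Suc (2 * l))) \<noteq> 1"
  by (simp add: thue_morse_seq_odd thue_morse_seq_even)

text \<open>At the first position \<open>j\<close> where a tail differs from the Thue--Morse sequence, the tail
  has the smaller digit. A tail starting at an odd position differs from it within the first two
  digits; one starting at an even position is compared through the recursion, which halves
  \<open>j\<close>.\<close>
lemma shift_thue_morse_seq_le: "lexle (shift k (thue_morse_seq e)) thue_morse"
proof -
  have "thue_morse_seq e (k + j) \<le> thue_morse j"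
    if "\<forall>i<j. thue_morse_seq e (k + i) = thue_morse i" for j k e
    using that
  proof (induction j arbitrary: k e rule: less_induct)
    case (less j)
    show ?case
    proof (cases "even k")
      case False
      then obtain l where k: "k = Suc (2 * l)"
        by (elim oddE) simp
      have "j < 2"
      proof (rule ccontr)
        assume "\<not> j < 2"
        then have "thue_morse_seq e k = 1" "thue_morse_seq e (Suc k) = 1"
          using less.prems[rule_format, of 0] less.prems[rule_format, of 1] by simp_all
        then show False
          using odd_tail_not_thue_morse[of e l] k by simp
      qed
      then have "thue_morse j = 1"
        by (auto simp: less_2_cases_iff)
      then show ?thesis
        using thue_morse_seq_range[of e "k + j"] by auto
    next
      case True
      then obtain l where k: "k = 2 * l"
        by (elim evenE)
      have at_odd: "thue_morse_seq e (k + Suc (2 * i)) = thue_morse_seq (Suc -` e) (l + i)" for i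
        using thue_morse_seq_odd[of e "l + i"] k by simp
      have at_even: "thue_morse_seq e (k + Suc (Suc (2 * i))) = 1 - thue_morse_seq (Suc -` e) (l + i)" for i
        using thue_morse_seq_even[of e "l + i"] k by simp
      show ?thesis
      proof (cases j rule: nat_parity_cases)
        case zero
        then show ?thesis
          using thue_morse_seq_range[of e k] by auto
      next
        case (odd i)
        have "thue_morse_seq (Suc -` e) (l + i') = thue_morse i'" if "i' < i" for i'
          using less.prems[rule_format, of "Suc (2 * i')"] that odd at_odd[of i']
            thue_morse_seq_odd[of UNIV i'] by simp
        then have "thue_morse_seq (Suc -` e) (l + i) \<le> thue_morse i"
          using less.IH[of i] odd by simp
        then show ?thesis
          using at_odd[of i] odd thue_morse_seq_odd[of UNIV i] by simp
      next
        case (even i)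
        have "thue_morse_seq e (k + Suc (2 * i)) = thue_morse (Suc (2 * i))"
          using less.prems even by (metis lessI)
        then show ?thesis
          using at_odd[of i] at_even[of i] even thue_morse_seq_odd[of UNIV i]
            thue_morse_seq_even[of UNIV i] by simp
      qed
    qed
  qed
  then show ?thesis
    by (simp add: lexle_def)
qed

lemma shift_thue_morse_seq_ne:
  assumes "0 < k"
  shows "shift k (thue_morse_seq e) \<noteq> thue_morse"
  using assms
proof (induction k arbitrary: e rule: less_induct)
  case (less k)
  show ?case
  proof
    assume eq: "shift k (thue_morse_seq e) = thue_morse"
    have eq': "thue_morse_seq e (k + i) = thue_morse i" for i
      using fun_cong[OF eq, of i] by simp
    show False
    proof (cases "even k")
      case True
      then obtain l where l: "k = 2 * l"
        by (elim evenE)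
      have "thue_morse_seq (Suc -` e) (l + i) = thue_morse i" for i
        using eq'[of "Suc (2 * i)"] l
          thue_morse_seq_odd[of e "l + i"] thue_morse_seq_odd[of UNIV i] by simp
      then have "shift l (thue_morse_seq (Suc -` e)) = thue_morse"
        by (simp add: fun_eq_iff)
      moreover have "l < k" "0 < l"
        using l less.prems by auto
      ultimately show False
        using less.IH by blast
    next
      case False
      then obtain l where "k = Suc (2 * l)"
        by (elim oddE) simp
      then show False
        using eq'[of 0] eq'[of 1] odd_tail_not_thue_morse[of e l] by simp
    qed
  qed
qed

lemma thue_morse_power: "thue_morse (2 ^ n - 1) = 1"
proof (induction n)
  case (Suc n)
  obtain m where m: "2 ^ n = Suc m"
    using not0_implies_Suc[of "2 ^ n"] by auto
  then have "2 ^ Suc n - 1 = Suc (2 * m)"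
    by simp
  then show ?case
    using Suc m thue_morse_seq_odd[of UNIV m] by simp
qed simp

lemma thue_morse_block: "i < 2 ^ n - 1 \<Longrightarrow> thue_morse (2 ^ n + i) = 1 - thue_morse i"
proof (induction n arbitrary: i)
  case (Suc n)
  obtain m where m: "2 ^ n = Suc m"
    using not0_implies_Suc[of "2 ^ n"] by auto
  show ?case
  proof (cases i rule: nat_parity_cases)
    case zero
    have "2 ^ Suc n + i = Suc (Suc (2 * m))"
      using zero m by simp
    then show ?thesis
      using zero m thue_morse_power[of n] thue_morse_seq_even[of UNIV m] by simp
  next
    case (odd l)
    have "thue_morse (2 ^ n + l) = 1 - thue_morse l"
      using Suc.prems odd by (intro Suc.IH) simp
    moreover have "2 ^ Suc n + i = Suc (2 * (2 ^ n + l))"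
      using odd by simp
    ultimately show ?thesis
      using odd thue_morse_seq_odd[of UNIV "2 ^ n + l"] thue_morse_seq_odd[of UNIV l] by simp
  next
    case (even l)
    have "thue_morse (2 ^ n + l) = 1 - thue_morse l"
      using Suc.prems even by (intro Suc.IH) simp
    moreover have "2 ^ Suc n + i = Suc (Suc (2 * (2 ^ n + l)))"
      using even by simp
    ultimately show ?thesis
      using even thue_morse_seq_even[of UNIV "2 ^ n + l"] thue_morse_seq_even[of UNIV l] by simp
  qed
qed simp

lemma reflect_shift_thue_morse_seq:
  "reflect 1 (shift k (thue_morse_seq e)) = shift k (thue_morse_seq (- e))"
  by (simp add: fun_eq_iff thue_morse_seq_complement)

interpretation two_digits: critical_family 1 thue_morse_seq thue_morse
proof
  show "thue_morse_seq e \<in> digits 1" for e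
  proof -
    have "0 \<le> thue_morse_seq e i \<and> thue_morse_seq e i \<le> 1" for i
      using thue_morse_seq_range[of e i] by auto
    then show ?thesis
      by (simp add: digits_def)
  qed
  show "thue_morse (2 ^ Suc n - 1) = 1 - thue_morse (2 ^ n - 1) + 1" for n
    unfolding thue_morse_power by simp
qed (simp_all add: inj_thue_morse_seq shift_thue_morse_seq_le shift_thue_morse_seq_ne
  reflect_shift_thue_morse_seq thue_morse_block)

text \<open>The sequences over \<open>{0, 1, 2}\<close> are obtained as \<open>1 + c\<^sub>n - c\<^sub>n\<^sub>-\<^sub>1\<close>, where the sequence
  \<open>c\<close> over \<open>{0, 1}\<close> is preceded by the digit 0. For the full index set this is
  21020121\<open>\<dots>\<close>, because \<open>\<tau>\<^sub>2\<^sub>i\<^sub>-\<^sub>1 = 1 - \<tau>\<^sub>i\<^sub>-\<^sub>1\<close> for \<open>i \<ge> 2\<close>.\<close>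
definition thue_morse_diff_seq :: "nat set \<Rightarrow> nat \<Rightarrow> int" where
  "thue_morse_diff_seq e n =
     1 + thue_morse_seq e n - (case n of 0 \<Rightarrow> 0 | Suc m \<Rightarrow> thue_morse_seq e m)"

abbreviation thue_morse_diff :: "nat \<Rightarrow> int" where
  "thue_morse_diff \<equiv> thue_morse_diff_seq UNIV"

text \<open>A difference equal to 2 determines both of its binary digits, 0 followed by 1. Since
  21020121\<open>\<dots>\<close> starts with 2, agreement of differences with it
  carries over to the underlying binary sequences.\<close>
lemma agree_from_differences:
  fixes b :: "nat \<Rightarrow> int"
  assumes "\<And>i. b i = 0 \<or> b i = 1" "0 < j"
    and diff: "\<And>i. i < j \<Longrightarrow> 1 + b (Suc (k + i)) - b (k + i) = thue_morse_diff i"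
  shows "\<And>i. i < j \<Longrightarrow> b (Suc (k + i)) = thue_morse i"
proof -
  fix i
  assume "i < j"
  then show "b (Suc (k + i)) = thue_morse i"
  proof (induction i)
    case 0
    have "1 + b (Suc k) - b k = 2"
      using diff[of 0] assms(2) by (simp add: thue_morse_diff_seq_def)
    then show ?case
      using assms(1)[of k] assms(1)[of "Suc k"] by auto
  next
    case (Suc i)
    then show ?case
      using diff[of "Suc i"] by (simp add: thue_morse_diff_seq_def)
  qed
qed

lemma difference_seq_le:
  fixes b :: "nat \<Rightarrow> int"
  assumes "\<And>i. b i = 0 \<or> b i = 1" "lexle (\<lambda>i. b (Suc (k + i))) thue_morse"
  shows "lexle (\<lambda>i. 1 + b (Suc (k + i)) - b (k + i)) thue_morse_diff"
  unfolding lexle_def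
proof (intro allI impI)
  fix j
  assume diff: "\<forall>i<j. 1 + b (Suc (k + i)) - b (k + i) = thue_morse_diff i"
  show "1 + b (Suc (k + j)) - b (k + j) \<le> thue_morse_diff j"
  proof (cases j)
    case 0
    then show ?thesis
      using assms(1)[of k] assms(1)[of "Suc k"] by (auto simp: thue_morse_diff_seq_def)
  next
    case (Suc m)
    have agree: "b (Suc (k + i)) = thue_morse i" if "i < j" for i
      using agree_from_differences[of b j k] assms(1) diff that Suc by blast
    then have "b (Suc (k + j)) \<le> thue_morse j"
      using lexleD[OF assms(2), of j] by simp
    then show ?thesis
      using agree[of m] Suc by (simp add: thue_morse_diff_seq_def)
  qed
qed

lemma difference_seq_eqD:
  fixes b :: "nat \<Rightarrow> int"
  assumes "\<And>i. b i = 0 \<or> b i = 1"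
    and "(\<lambda>i. 1 + b (Suc (k + i)) - b (k + i)) = thue_morse_diff"
  shows "(\<lambda>i. b (Suc (k + i))) = thue_morse"
proof
  fix i
  show "b (Suc (k + i)) = thue_morse i"
    using agree_from_differences[of b "Suc i" k i] assms(1) fun_cong[OF assms(2)] by blast
qed

text \<open>Tails and reflected tails of the new family are again differences of binary sequences;
  reflection turns the leading digit 0 into 1.\<close>
lemma shift_thue_morse_diff_seq:
  "shift k (thue_morse_diff_seq e)
     = (\<lambda>i. 1 + case_nat 0 (thue_morse_seq e) (Suc (k + i)) - case_nat 0 (thue_morse_seq e) (k + i))"
  by (simp add: fun_eq_iff thue_morse_diff_seq_def)

lemma reflect_shift_thue_morse_diff_seq:
  "reflect 2 (shift k (thue_morse_diff_seq e)) = (\<lambda>i. 1 + case_nat 1 (thue_morse_seq (- e)) (Suc (k + i))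
     - case_nat 1 (thue_morse_seq (- e)) (k + i))"
  by (auto simp: fun_eq_iff thue_morse_diff_seq_def thue_morse_seq_complement split: nat.split)

lemma case_nat_range:
  "a = 0 \<or> a = 1 \<Longrightarrow> case_nat a (thue_morse_seq e) i = 0 \<or> case_nat a (thue_morse_seq e) i = 1"
  using thue_morse_seq_range by (cases i) auto

lemma inj_thue_morse_diff_seq: "inj thue_morse_diff_seq"
proof (rule injI)
  fix e e'
  assume eq: "thue_morse_diff_seq e = thue_morse_diff_seq e'"
  have "thue_morse_seq e n = thue_morse_seq e' n" for n
  proof (induction n)
    case 0
    show ?case
      using fun_cong[OF eq, of 0] by (simp add: thue_morse_diff_seq_def)
  next
    case (Suc n)
    then show ?case
      using fun_cong[OF eq, of "Suc n"] by (simp add: thue_morse_diff_seq_def)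
  qed
  then have "thue_morse_seq e = thue_morse_seq e'"
    by (rule ext)
  then show "e = e'"
    using inj_thue_morse_seq by (simp add: inj_eq)
qed

lemma thue_morse_diff_block:
  assumes "i < 2 ^ n - 1"
  shows "thue_morse_diff (2 ^ n + i) = 2 - thue_morse_diff i"
proof (cases i)
  case 0
  obtain m where m: "2 ^ n = Suc m"
    using not0_implies_Suc[of "2 ^ n"] by auto
  then have "thue_morse m = 1"
    using thue_morse_power[of n] by simp
  then show ?thesis
    using 0 m thue_morse_block[OF assms] by (simp add: thue_morse_diff_seq_def)
next
  case (Suc l)
  then show ?thesis
    using thue_morse_block[OF assms] thue_morse_block[of l n] assms
    by (simp add: thue_morse_diff_seq_def)
qed

lemma thue_morse_diff_last: "thue_morse_diff (2 ^ Suc n - 1) = 2 - thue_morse_diff (2 ^ n - 1) + 1"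
proof (cases n)
  case 0
  then show ?thesis
    using thue_morse_1 by (simp add: thue_morse_diff_seq_def)
next
  case (Suc m)
  obtain p where "2 ^ m = Suc p"
    using not0_implies_Suc[of "2 ^ m"] by auto
  then obtain l where l: "2 ^ n = Suc (Suc l)"
    using Suc by simp
  have "thue_morse (2 ^ n + l) = 1 - thue_morse l"
    using l by (intro thue_morse_block) simp
  moreover have "2 ^ n - 1 = Suc l" "2 ^ Suc n - 1 = Suc (2 ^ n + l)"
    using l by simp_all
  ultimately show ?thesis
    using thue_morse_power[of n] thue_morse_power[of "Suc n"]
    by (simp add: thue_morse_diff_seq_def)
qed

interpretation three_digits: critical_family 2 thue_morse_diff_seq thue_morse_diff
proof
  show "thue_morse_diff_seq e \<in> digits 2" for e
  proof -
    have "0 \<le> thue_morse_diff_seq e n \<and> thue_morse_diff_seq e n \<le> 2" for n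
      using case_nat_range[of 0 e n] thue_morse_seq_range[of e n]
      by (auto simp: thue_morse_diff_seq_def)
    then show ?thesis
      by (simp add: digits_def)
  qed
  show "lexle (shift k (thue_morse_diff_seq e)) thue_morse_diff" for k e
    unfolding shift_thue_morse_diff_seq
    using shift_thue_morse_seq_le[of k e]
    by (intro difference_seq_le case_nat_range) (simp_all add: shift_def)
  show "lexle (reflect 2 (shift k (thue_morse_diff_seq e))) thue_morse_diff" for k e
    unfolding reflect_shift_thue_morse_diff_seq
    using shift_thue_morse_seq_le[of k "- e"]
    by (intro difference_seq_le case_nat_range) (simp_all add: shift_def)
  show "shift k (thue_morse_diff_seq e) \<noteq> thue_morse_diff" if "0 < k" for k e
  proof
    assume "shift k (thue_morse_diff_seq e) = thue_morse_diff"
    from difference_seq_eqD[OF case_nat_range this[unfolded shift_thue_morse_diff_seq]]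
    show False
      using shift_thue_morse_seq_ne[OF that, of e] by (simp add: shift_def)
  qed
  show "reflect 2 (shift k (thue_morse_diff_seq e)) \<noteq> thue_morse_diff" if "0 < k" for k e
  proof
    assume "reflect 2 (shift k (thue_morse_diff_seq e)) = thue_morse_diff"
    from difference_seq_eqD[OF case_nat_range this[unfolded reflect_shift_thue_morse_diff_seq]]
    show False
      using shift_thue_morse_seq_ne[OF that, of "- e"] by (simp add: shift_def)
  qed
  show "thue_morse_diff 0 = 2"
    by (simp add: thue_morse_diff_seq_def)
qed (simp_all only: inj_thue_morse_diff_seq thue_morse_diff_block thue_morse_diff_last simp_thms)

section \<open>The cardinality of the set of univoque numbers\<close>

lemma q_prime_eq: "q_prime = two_digits.critical_base"
  unfolding q_prime_def
proof (rule Least_equality)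
  show "two_digits.critical_base \<in> univoque_bases"
    by (rule two_digits.critical_base_univoque)
  show "two_digits.critical_base \<le> q" if "q \<in> univoque_bases" for q
    using that by (intro two_digits.critical_base_le) (auto simp: univoque_bases_def)
qed

lemma q_double_prime_eq: "q_double_prime = three_digits.critical_base"
  unfolding q_double_prime_def
proof (rule Least_equality)
  show "three_digits.critical_base \<in> univoque_bases \<inter> {2<..<3}"
    using three_digits.critical_base_univoque three_digits.critical_base by simp
  show "three_digits.critical_base \<le> q" if "q \<in> univoque_bases \<inter> {2<..<3}" for q
    using that by (intro three_digits.critical_base_le) auto
qed

lemma univoque_numbers_up_to_golden_ratio:
  assumes q: "1 < q" "q \<le> golden_ratio"
  shows "univoque_numbers q = {Inf (J q), Sup (J q)}"
proof -
  have "golden_ratio \<le> 2"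
    using less_golden_ratio_iff[of 2] by simp
  then have q2: "q \<le> 2"
    using q by simp
  then have "\<lceil>q\<rceil> = 2"
    using q by (intro ceiling_unique) auto
  then have J: "J q = {0..1 / (q - 1)}"
    by (simp add: J_def)
  have "univoque_numbers q = val q ` {\<lambda>_. 0, \<lambda>_. 1}"
    using univoque_numbers_eq[of q 1] univoque_seqs_up_to_golden_ratio[OF q] q q2 by simp
  then show ?thesis
    using q J by (simp add: val_const)
qed

theorem theorem1p9:
  fixes q :: real
  assumes "q > 1"
  shows
    "(q \<in> {1<..golden_ratio} \<longrightarrow> univoque_numbers q = {Inf (J q), Sup (J q)}) \<and>
     (q \<in> {golden_ratio<..<q_prime} \<union> {2<..<q_double_prime} \<longrightarrow>
        univoque_numbers q \<approx> (UNIV :: nat set)) \<and>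
     (q \<in> {q_prime..2} \<union> {q_double_prime..} \<longrightarrow>
        univoque_numbers q \<approx> (UNIV :: nat set set))"
proof (intro conjI impI)
  assume "q \<in> {1<..golden_ratio}"
  then show "univoque_numbers q = {Inf (J q), Sup (J q)}"
    by (intro univoque_numbers_up_to_golden_ratio) auto
next
  assume "q \<in> {golden_ratio<..<q_prime} \<union> {2<..<q_double_prime}"
  then show "univoque_numbers q \<approx> (UNIV :: nat set)"
  proof
    assume q: "q \<in> {golden_ratio<..<q_prime}"
    then show ?thesis
      using assms two_digits.critical_base
      by (intro univoque_numbers_eqpoll_nat[of q 1] infinite_univoque_seqs_above_golden_ratio
          two_digits.countable_univoque_seqs_below) (auto simp: q_prime_eq)
  next
    assume q: "q \<in> {2<..<q_double_prime}"
    then show ?thesis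
      using assms three_digits.critical_base
      by (intro univoque_numbers_eqpoll_nat[of q 2] infinite_univoque_seqs_above_2
          three_digits.countable_univoque_seqs_below) (auto simp: q_double_prime_eq)
  qed
next
  assume "q \<in> {q_prime..2} \<union> {q_double_prime..}"
  then consider "q_prime \<le> q" "q \<le> 2" | "q_double_prime \<le> q" "q \<le> 3" | "3 < q"
    by force
  then show "univoque_numbers q \<approx> (UNIV :: nat set set)"
  proof cases
    case 1
    then show ?thesis
      using two_digits.univoque_numbers_eqpoll_from_critical_base by (simp add: q_prime_eq)
  next
    case 2
    then show ?thesis
      using three_digits.univoque_numbers_eqpoll_from_critical_base by (simp add: q_double_prime_eq)
  next
    case 3
    then show ?thesis
      by (rule univoque_numbers_eqpoll_above_3)
  qed
qed

end
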